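(* Let $K$ be a field, $P=K[x_1,\dots,x_n]$, $I\subset P$ a 0-dimensional ideal, and $R=P/I$. Then the following conditions are equivalent. (a) The ring $R$ is a strict Gorenstein ring. (b) The ring $R$ has the strict Cayley-Bacharach property and satisfies $\Delta_R=1$.
   Context: Setting: $I$ is a proper ideal of $P=K[x_1,\dots,x_n]$ such that $\dim_K(P/I)<\infty$; $R=P/I$ is always considered with this fixed presentation. Degree filtration: $F_iP=\{f\in P\mid \deg f\le i\}\cup\{0\}$, $F_iI=F_iP\cap I$, and $F_iR=F_iP/F_iI$ is the image of $F_iP$ in $R$ ($i\in\mathbb Z$). $\mathrm{HF}^a_R(i)=\dim_K F_iR$. The regularity index is $\mathrm{ri}(R)=\min\{i\in\mathbb Z\mid \mathrm{HF}^a_R(j)=\dim_K R \text{ for all } j\ge i\}$, and the last difference is $\Delta_R=\mathrm{HF}^a_R(\mathrm{ri}(R))-\mathrm{HF}^a_R(\mathrm{ri}(R)-1)$. For $f\in R\setminus\{0\}$, $\mathrm{ord}_{\mathcal F}(f)=\min\{i\mid f\in F_iR\}$. Cayley-Bacharach property (CBP): let $I=\mathfrak Q_1\cap\dots\cap\mathfrak Q_s$ be the primary decomposition, $\mathfrak M_i=\mathrm{Rad}(\mathfrak Q_i)$ (maximal ideals), $\ell_i=\dim_K(P/\mathfrak M_i)$. A $\mathfrak Q_i$-divisor of $I$ is an ideal $J=\mathfrak Q_1\cap\dots\cap\mathfrak Q_i'\cap\dots\cap\mathfrak Q_s$ ($\mathfrak Q_i$ replaced by $\mathfrak Q_i'$),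 where $\mathfrak Q_i'$ is an ideal of $P$ with $\mathfrak Q_i\subsetneq\mathfrak Q_i'$ (so $\mathfrak Q_i'\subseteq\mathfrak M_i$ or $\mathfrak Q_i'=P$). It is minimal if $\dim_K(J/I)=\ell_i$. For a minimal $\mathfrak Q_i$-divisor $J$ with image $\bar J=J/I$ in $R$, put $\mathrm{ri}(\bar J)=\max\{\mathrm{ord}_{\mathcal F}(f)\mid f\in\bar J\setminus\{0\}\}$. $R$ has the CBP if for every $i\in\{1,\dots,s\}$ and every minimal $\mathfrak Q_i$-divisor $J$ of $I$ we have $\mathrm{ri}(\bar J)=\mathrm{ri}(R)$. Graded ring: $\mathrm{gr}_{\mathcal F}(R)=\bigoplus_{i\in\mathbb Z}F_iR/F_{i-1}R\cong P/\mathrm{DF}(I)$, where $\mathrm{DF}(I)$ is the ideal generated by the degree forms (top-degree homogeneous components) of the non-zero elements of $I$; it is a 0-dimensional affine $K$-algebra considered with the presentation $P/\mathrm{DF}(I)$. $R$ has the strict Cayley-Bacharach property if $\mathrm{gr}_{\mathcal F}(R)=P/\mathrm{DF}(I)$ has the CBP. $R$ is a strict Gorenstein ring if $\mathrm{gr}_{\mathcal F}(R)$ is a local Gorenstein ring, where a 0-dimensional local ring $(A,\mathfrak m)$ is Gorenstein if $\dim_{A/\mathfrak m}\mathrm{Ann}_A(\mathfrak m)=1$. *)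

theory Defs
  imports
    "HOL-Library.Poly_Mapping"
    "HOL-Algebra.Algebraic_Closure_Type"
    "Jordan_Normal_Form.Missing_VectorSpace"
begin

section \<open>The polynomial ring and its degree filtration\<close>

text \<open>
  The indeterminates are the elements of a finite type, so n is the cardinality of that type. A
  power product is a finitely supported exponent function, and a polynomial is a finitely
  supported coefficient function on power products, with the convolution product of
  \<^theory>\<open>HOL-Library.Poly_Mapping\<close>.
\<close>

type_synonym ('x, 'k) mpoly = "('x \<Rightarrow>\<^sub>0 nat) \<Rightarrow>\<^sub>0 'k"

abbreviation mpoly_ring :: "('x::finite, 'k::field) mpoly ring" where
  "mpoly_ring \<equiv> ring_of_type_algebra"

abbreviation coeff_field :: "'k::field ring" where
  "coeff_field \<equiv> ring_of_type_algebra"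

definition const_poly :: "'k::field \<Rightarrow> ('x::finite, 'k) mpoly" where
  "const_poly c = Poly_Mapping.single 0 c"

definition mon_deg :: "('x::finite \<Rightarrow>\<^sub>0 nat) \<Rightarrow> nat" where
  "mon_deg t = (\<Sum>x\<in>UNIV. Poly_Mapping.lookup t x)"

text \<open>The total degree; meaningful only for non-zero polynomials.\<close>

definition tot_deg :: "('x::finite, 'k::field) mpoly \<Rightarrow> nat" where
  "tot_deg f = Max (mon_deg ` Poly_Mapping.keys f)"

definition degree_form :: "('x::finite, 'k::field) mpoly \<Rightarrow> ('x, 'k) mpoly" where
  "degree_form f =
     (\<Sum>t \<in> {t \<in> Poly_Mapping.keys f. mon_deg t = tot_deg f}.
        Poly_Mapping.single t (Poly_Mapping.lookup f t))"

definition filt_P :: "int \<Rightarrow> ('x::finite, 'k::field) mpoly set" where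
  "filt_P i = {f. f \<noteq> 0 \<and> int (tot_deg f) \<le> i} \<union> {0}"

definition DF :: "('x::finite, 'k::field) mpoly set \<Rightarrow> ('x, 'k) mpoly set" where
  "DF I = Idl\<^bsub>mpoly_ring\<^esub> (degree_form ` (I - {0}))"


section \<open>The quotient P/I as a K-vector space with filtration\<close>

definition quot_image ::
    "('x::finite, 'k::field) mpoly set \<Rightarrow> ('x, 'k) mpoly set \<Rightarrow> ('x, 'k) mpoly set set" where
  "quot_image I S = (\<lambda>f. I +>\<^bsub>mpoly_ring\<^esub> f) ` S"

definition quot_space ::
    "('x::finite, 'k::field) mpoly set \<Rightarrow> ('k, ('x, 'k) mpoly set) module" where
  "quot_space I =
     ring.extend (mpoly_ring Quot I)
       (module.fields (\<lambda>c C. (I +>\<^bsub>mpoly_ring\<^esub> const_poly c) \<otimes>\<^bsub>mpoly_ring Quot I\<^esub> C))"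

text \<open>Dimension over K of a K-subspace V of P/I.\<close>

definition dim_K ::
    "('x::finite, 'k::field) mpoly set \<Rightarrow> ('x, 'k) mpoly set set \<Rightarrow> nat" where
  "dim_K I V = vectorspace.dim coeff_field ((quot_space I)\<lparr>carrier := V\<rparr>)"

definition zero_dim_ideal :: "('x::finite, 'k::field) mpoly set \<Rightarrow> bool" where
  "zero_dim_ideal I \<longleftrightarrow>
     ideal I mpoly_ring \<and> I \<noteq> carrier mpoly_ring \<and>
     vectorspace.fin_dim coeff_field (quot_space I)"

definition filt_R ::
    "('x::finite, 'k::field) mpoly set \<Rightarrow> int \<Rightarrow> ('x, 'k) mpoly set set" where
  "filt_R I i = quot_image I (filt_P i)"

definition HFa :: "('x::finite, 'k::field) mpoly set \<Rightarrow> int \<Rightarrow> nat" where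
  "HFa I i = dim_K I (filt_R I i)"

definition ri :: "('x::finite, 'k::field) mpoly set \<Rightarrow> int" where
  "ri I = (LEAST i. \<forall>j\<ge>i. HFa I j = dim_K I (carrier (mpoly_ring Quot I)))"

definition last_difference :: "('x::finite, 'k::field) mpoly set \<Rightarrow> int" where
  "last_difference I = int (HFa I (ri I)) - int (HFa I (ri I - 1))"

definition ord_F ::
    "('x::finite, 'k::field) mpoly set \<Rightarrow> ('x, 'k) mpoly set \<Rightarrow> int" where
  "ord_F I f = (LEAST i. f \<in> filt_R I i)"

text \<open>The regularity index of an ideal of P/I.\<close>

definition ri_ideal ::
    "('x::finite, 'k::field) mpoly set \<Rightarrow> ('x, 'k) mpoly set set \<Rightarrow> int" where
  "ri_ideal I B = Max (ord_F I ` (B - {\<zero>\<^bsub>mpoly_ring Quot I\<^esub>}))"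


section \<open>Primary decomposition and the Cayley-Bacharach property\<close>

definition primary_ideal :: "'a set \<Rightarrow> ('a, 'b) ring_scheme \<Rightarrow> bool" where
  "primary_ideal Q R \<longleftrightarrow>
     ideal Q R \<and> Q \<noteq> carrier R \<and>
     (\<forall>a \<in> carrier R. \<forall>b \<in> carrier R.
        a \<otimes>\<^bsub>R\<^esub> b \<in> Q \<longrightarrow> a \<in> Q \<or> (\<exists>n::nat. b [^]\<^bsub>R\<^esub> n \<in> Q))"

definition radical :: "('a, 'b) ring_scheme \<Rightarrow> 'a set \<Rightarrow> 'a set" where
  "radical R I = {a \<in> carrier R. \<exists>n::nat. a [^]\<^bsub>R\<^esub> n \<in> I}"

text \<open>
  The set of components of a minimal primary decomposition: the radicals are pairwise distinct
  and no component can be omitted. Intersecting with the carrier gives the empty intersection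
  its intended value.
\<close>

definition primary_decomposition ::
    "('a, 'b) ring_scheme \<Rightarrow> 'a set set \<Rightarrow> 'a set \<Rightarrow> bool" where
  "primary_decomposition R QS I \<longleftrightarrow>
     finite QS \<and> (\<forall>Q\<in>QS. primary_ideal Q R) \<and> I = carrier R \<inter> \<Inter>QS \<and>
     inj_on (radical R) QS \<and> (\<forall>Q\<in>QS. carrier R \<inter> \<Inter>(QS - {Q}) \<noteq> I)"

text \<open>J is a Q-divisor of the ideal whose primary components form the set QS.\<close>

definition component_divisor ::
    "('x::finite, 'k::field) mpoly set set \<Rightarrow> ('x, 'k) mpoly set \<Rightarrow> ('x, 'k) mpoly set \<Rightarrow> bool" where
  "component_divisor QS Q J \<longleftrightarrow>
     (\<exists>Q'. ideal Q' mpoly_ring \<and> Q \<subset> Q' \<and> J = Q' \<inter> \<Inter>(QS - {Q}))"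

definition minimal_divisor ::
    "('x::finite, 'k::field) mpoly set \<Rightarrow> ('x, 'k) mpoly set set \<Rightarrow> ('x, 'k) mpoly set \<Rightarrow>
     ('x, 'k) mpoly set \<Rightarrow> bool" where
  "minimal_divisor I QS Q J \<longleftrightarrow>
     component_divisor QS Q J \<and>
     dim_K I (quot_image I J) =
       dim_K (radical mpoly_ring Q) (carrier (mpoly_ring Quot radical mpoly_ring Q))"

text \<open>
  The primary decomposition of a 0-dimensional ideal exists and is unique, so the quantifier
  over \<open>QS\<close> has exactly one instance.
\<close>

definition CBP :: "('x::finite, 'k::field) mpoly set \<Rightarrow> bool" where
  "CBP I \<longleftrightarrow>
     (\<forall>QS. primary_decomposition mpoly_ring QS I \<longrightarrow>
        (\<forall>Q\<in>QS. \<forall>J. minimal_divisor I QS Q J \<longrightarrow> ri_ideal I (quot_image I J) = ri I))"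

text \<open>The associated graded ring of P/I is presented as P/DF(I).\<close>

definition strict_CBP :: "('x::finite, 'k::field) mpoly set \<Rightarrow> bool" where
  "strict_CBP I \<longleftrightarrow> CBP (DF I)"


section \<open>0-dimensional local Gorenstein rings\<close>

definition annihilator :: "('a, 'b) ring_scheme \<Rightarrow> 'a set \<Rightarrow> 'a set" where
  "annihilator A S = {a \<in> carrier A. \<forall>x\<in>S. a \<otimes>\<^bsub>A\<^esub> x = \<zero>\<^bsub>A\<^esub>}"

text \<open>
  The annihilator of an ideal m as a module over A/m. The product of v with a coset C does not
  depend on the representative a, because v is annihilated by m.
\<close>

definition socle_space :: "'a ring \<Rightarrow> 'a set \<Rightarrow> ('a set, 'a) module" where
  "socle_space A m =
     ring.extend (A\<lparr>carrier := annihilator A m\<rparr>)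
       (module.fields (\<lambda>C v. THE w. \<exists>a\<in>C. w = a \<otimes>\<^bsub>A\<^esub> v))"

text \<open>Krull dimension 0 is the condition that every prime ideal is maximal.\<close>

definition zero_dim_local_Gorenstein :: "'a ring \<Rightarrow> bool" where
  "zero_dim_local_Gorenstein A \<longleftrightarrow>
     cring A \<and> (\<forall>p. primeideal p A \<longrightarrow> maximalideal p A) \<and>
     (\<exists>m. (\<forall>m'. maximalideal m' A \<longleftrightarrow> m' = m) \<and>
        vectorspace.fin_dim (A Quot m) (socle_space A m) \<and>
        vectorspace.dim (A Quot m) (socle_space A m) = 1)"

definition strict_Gorenstein :: "('x::finite, 'k::field) mpoly set \<Rightarrow> bool" where
  "strict_Gorenstein I \<longleftrightarrow> zero_dim_local_Gorenstein (mpoly_ring Quot DF I)"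

end

theory Submission
  imports Defs
begin

text \<open>
  Let \<open>D = DF(I)\<close> and let \<open>r\<close> be the top degree in which \<open>P/D\<close> is non-zero. The homogeneous
  elements of degree \<open>i\<close> in \<open>D\<close> are the degree \<open>i\<close> parts of the elements of \<open>I\<close> of degree at most
  \<open>i\<close>; hence \<open>r\<close> is the regularity index of both \<open>I\<close> and \<open>D\<close>, and \<open>\<Delta>\<close> is the dimension of the
  degree \<open>r\<close> part of \<open>P/D\<close>. The ring \<open>P/D\<close> is local with residue field \<open>K\<close>, so the minimal divisors
  of \<open>D\<close> are the lines in the socle, and the Cayley-Bacharach property says that the socle meets
  \<open>F\<^sub>r\<^sub>-\<^sub>1\<close> only in \<open>0\<close>. The socle always contains the degree \<open>r\<close> part. If it is a line, it
  therefore equals the degree \<open>r\<close> part, whose non-zero elements have order \<open>r\<close>. Conversely, if the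
  socle avoids \<open>F\<^sub>r\<^sub>-\<^sub>1\<close> and \<open>F\<^sub>r\<^sub>-\<^sub>1\<close> has codimension \<open>1\<close>, the socle is a line.
\<close>


section \<open>Dimensions of subspaces\<close>

context vectorspace
begin

lemma submodule_vectorspace:
  assumes "submodule K W V"
  shows "vectorspace K (vs W)"
  using assms subspace_is_vs subspace_def vectorspace_axioms by blast

text \<open>Independent subsets of \<open>W\<close> have at most \<open>dim\<close> elements, so a
  maximal one exists. Dependence and span mean the same in \<open>W\<close> as in \<open>V\<close>,
  hence it is a basis of \<open>W\<close>.\<close>

lemma submodule_finite_basis:
  assumes "fin_dim" and W: "submodule K W V"
  obtains B where "finite B" "B \<subseteq> W" "lin_indpt B" "span B = W"
    "vectorspace.dim K (vs W) = card B"
proof -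
  interpret W: vectorspace K "vs W" by (rule submodule_vectorspace[OF W])
  have WV: "W \<subseteq> carrier V" using W by (simp add: submodule_def)
  have ld: "W.lin_dep S = lin_dep S" "W.span S = span S" if "S \<subseteq> W" for S
    using span_li_not_depend[OF that W] by simp_all
  let ?P = "\<lambda>S. S \<subseteq> W \<and> lin_indpt S"
  have "finite A \<and> card A \<le> dim" if "?P A" for A
    using li_le_dim[OF assms(1), of A] that WV by auto
  moreover have "?P {}" by (auto simp: lin_dep_def)
  ultimately obtain B where B: "finite B" "maximal B ?P"
    using maximal_exists[of ?P dim "{}"] by blast
  then have BW: "B \<subseteq> W" "lin_indpt B" by (auto simp: maximal_def)
  have "maximal B (\<lambda>S. S \<subseteq> carrier (vs W) \<and> W.lin_indpt S)"
    using B(2) by (simp add: ld(1) cong: conj_cong)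
  then have bas: "W.basis B" by (rule W.max_li_is_basis)
  then have "span B = W" using ld(2)[OF BW(1)] by (simp add: W.basis_def)
  then show ?thesis using that[OF B(1) BW] W.dim_basis[OF B(1) bas] by simp
qed

lemma submodule_fin_dim:
  assumes "fin_dim" and W: "submodule K W V"
  shows "vectorspace.fin_dim K (vs W)"
proof -
  interpret W: vectorspace K "vs W" by (rule submodule_vectorspace[OF W])
  obtain B where B: "finite B" "B \<subseteq> W" "span B = W"
    using submodule_finite_basis[OF assms] by metis
  then have "W.span B = W" using span_li_not_depend[OF B(2) W] by simp
  with B show ?thesis by (auto simp: W.fin_dim_def)
qed

text \<open>A basis of \<open>W\<close> is an independent set of \<open>dim\<close> vectors of
  \<open>V\<close>, and such a set already spans \<open>V\<close>.\<close>

lemma submodule_eq_carrier_if_dim_eq: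
  assumes "fin_dim" and W: "submodule K W V" and "vectorspace.dim K (vs W) = dim"
  shows "W = carrier V"
proof -
  obtain B where B: "finite B" "B \<subseteq> W" "lin_indpt B" "span B = W" "card B = dim"
    using submodule_finite_basis[OF assms(1,2)] assms(3) by metis
  have "W \<subseteq> carrier V" using W by (simp add: submodule_def)
  then have "basis B" using B by (intro dim_li_is_basis[OF assms(1)]) auto
  then show ?thesis using B by (simp add: basis_def)
qed

lemma span_insert_iff:
  assumes "finite B" "B \<subseteq> carrier V" "c \<in> carrier V" "c \<notin> B"
  shows "v \<in> span (B \<union> {c}) \<longleftrightarrow> (\<exists>a\<in>carrier K. \<exists>u\<in>span B. v = a \<odot>\<^bsub>V\<^esub> c \<oplus>\<^bsub>V\<^esub> u)"
proof
  assume "v \<in> span (B \<union> {c})"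
  then obtain f where f: "f \<in> B \<union> {c} \<rightarrow> carrier K" "v = lincomb f (B \<union> {c})"
    using finite_span[of "B \<union> {c}"] assms by auto
  then have "v = f c \<odot>\<^bsub>V\<^esub> c \<oplus>\<^bsub>V\<^esub> lincomb f B"
    using lincomb_insert[of B f c] assms by simp
  moreover have "lincomb f B \<in> span B" using f assms finite_span[of B] by auto
  ultimately show "\<exists>a\<in>carrier K. \<exists>u\<in>span B. v = a \<odot>\<^bsub>V\<^esub> c \<oplus>\<^bsub>V\<^esub> u" using f by auto
next
  assume "\<exists>a\<in>carrier K. \<exists>u\<in>span B. v = a \<odot>\<^bsub>V\<^esub> c \<oplus>\<^bsub>V\<^esub> u"
  then obtain a u where au: "a \<in> carrier K" "u \<in> span B" "v = a \<odot>\<^bsub>V\<^esub> c \<oplus>\<^bsub>V\<^esub> u" by blast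
  have sub: "B \<union> {c} \<subseteq> carrier V" using assms by auto
  have "submodule K (span (B \<union> {c})) V" by (rule span_is_submodule[OF sub])
  moreover have "c \<in> span (B \<union> {c})" using in_own_span[OF sub] by auto
  moreover have "u \<in> span (B \<union> {c})" using span_is_monotone[of B "B \<union> {c}"] au by auto
  ultimately show "v \<in> span (B \<union> {c})" using au by (auto simp: submodule_def)
qed

text \<open>A basis of \<open>W\<close> together with one vector \<open>c\<close> outside
  \<open>W\<close> stays independent; codimension one means that it spans. The right-hand side
  mentions only vectors, so it can later be rewritten in terms of polynomials.\<close>

lemma dim_eq_Suc_submodule_iff:
  assumes "fin_dim" and W: "submodule K W V"
  shows "dim = Suc (vectorspace.dim K (vs W)) \<longleftrightarrow>
    (\<exists>c\<in>carrier V - W. \<forall>v\<in>carrier V. \<exists>a\<in>carrier K. \<exists>u\<in>W. v = a \<odot>\<^bsub>V\<^esub> c \<oplus>\<^bsub>V\<^esub> u)"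
    (is "?L \<longleftrightarrow> ?R")
proof -
  obtain B where B: "finite B" "B \<subseteq> W" "lin_indpt B" "span B = W"
    "vectorspace.dim K (vs W) = card B"
    using submodule_finite_basis[OF assms(1,2)] by metis
  have WV: "W \<subseteq> carrier V" using W by (simp add: submodule_def)
  have notin: "c \<notin> B" if "c \<in> carrier V - W" for c
    using B(2) that by blast
  have ins: "finite (B \<union> {c})" "card (B \<union> {c}) = Suc (card B)" "B \<union> {c} \<subseteq> carrier V"
    if c: "c \<in> carrier V - W" for c
    using B(1,2) WV c notin[OF c] by auto
  have indpt: "lin_indpt (B \<union> {c})" if c: "c \<in> carrier V - W" for c
    using lin_dep_iff_in_span[of B c] B(2-4) WV c notin[OF c] by blast
  have sp: "v \<in> span (B \<union> {c}) \<longleftrightarrow> (\<exists>a\<in>carrier K. \<exists>u\<in>W. v = a \<odot>\<^bsub>V\<^esub> c \<oplus>\<^bsub>V\<^esub> u)"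
    if c: "c \<in> carrier V - W" for c v
    using span_insert_iff[of B c v] B(1,2,4) WV c notin[OF c] by auto
  show ?thesis
  proof
    assume L: ?L
    have "W \<noteq> carrier V" using L by auto
    then obtain c where c: "c \<in> carrier V - W" using WV by auto
    have "basis (B \<union> {c})"
      using dim_li_is_basis[OF assms(1) ins(1)[OF c] ins(3)[OF c] indpt[OF c]] ins(2)[OF c] L B(5)
      by simp
    then show ?R using sp[OF c] c by (auto simp: basis_def)
  next
    assume ?R
    then obtain c where c: "c \<in> carrier V - W"
      and R: "\<forall>v\<in>carrier V. \<exists>a\<in>carrier K. \<exists>u\<in>W. v = a \<odot>\<^bsub>V\<^esub> c \<oplus>\<^bsub>V\<^esub> u" ..
    have "carrier V \<subseteq> span (B \<union> {c})" using R unfolding sp[OF c, symmetric] by auto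
    then have "span (B \<union> {c}) = carrier V"
      using span_is_subset2[OF ins(3)[OF c]] by blast
    then have "basis (B \<union> {c})" using ins(3)[OF c] indpt[OF c] by (simp add: basis_def)
    then show ?L using dim_basis[OF ins(1)[OF c]] ins(2)[OF c] B(5) by simp
  qed
qed

lemma zero_submodule: "submodule K {\<zero>\<^bsub>V\<^esub>} V"
  by (unfold_locales) auto

lemma zero_submodule_dim: "vectorspace.dim K (vs {\<zero>\<^bsub>V\<^esub>}) = 0"
proof -
  interpret W: vectorspace K "vs {\<zero>\<^bsub>V\<^esub>}" by (rule submodule_vectorspace[OF zero_submodule])
  show ?thesis
    by (rule W.dim0I) (use W.span_is_subset2[of "{\<zero>\<^bsub>V\<^esub>}"] W.in_own_span[of "{\<zero>\<^bsub>V\<^esub>}"] in auto)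
qed

lemma dim_eq_1_iff:
  assumes "fin_dim"
  shows "dim = 1 \<longleftrightarrow>
    (\<exists>c\<in>carrier V - {\<zero>\<^bsub>V\<^esub>}. \<forall>v\<in>carrier V. \<exists>a\<in>carrier K. v = a \<odot>\<^bsub>V\<^esub> c)"
proof -
  have "a \<odot>\<^bsub>V\<^esub> c \<oplus>\<^bsub>V\<^esub> \<zero>\<^bsub>V\<^esub> = a \<odot>\<^bsub>V\<^esub> c" if "c \<in> carrier V" "a \<in> carrier K" for a c
    using that by simp
  then show ?thesis
    using dim_eq_Suc_submodule_iff[OF assms zero_submodule] zero_submodule_dim by auto
qed

end


section \<open>Ideals and quotients of the polynomial ring\<close>

lemma ring_of_type_algebra_simps [simp]:
  fixes a b :: "'a :: comm_ring_1"
  shows "carrier (ring_of_type_algebra :: 'a ring) = UNIV"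
    and "a \<otimes>\<^bsub>ring_of_type_algebra\<^esub> b = a * b"
    and "a \<oplus>\<^bsub>ring_of_type_algebra\<^esub> b = a + b"
    and "\<zero>\<^bsub>ring_of_type_algebra\<^esub> = (0 :: 'a)"
    and "\<one>\<^bsub>ring_of_type_algebra\<^esub> = (1 :: 'a)"
  by (simp_all add: ring_of_type_algebra_def)

lemma minus_ring_of_type_algebra [simp]:
  fixes a b :: "'a :: comm_ring_1"
  shows "\<ominus>\<^bsub>ring_of_type_algebra\<^esub> a = - a"
    and "a \<ominus>\<^bsub>ring_of_type_algebra\<^esub> b = a - b"
proof -
  interpret R: cring "ring_of_type_algebra :: 'a ring" by (rule cring_from_type_algebra)
  show m: "\<ominus>\<^bsub>ring_of_type_algebra\<^esub> a = - a" for a :: 'a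
    using R.minus_equality[of "- a" a] by simp
  show "a \<ominus>\<^bsub>ring_of_type_algebra\<^esub> b = a - b"
    by (simp add: a_minus_def m)
qed

lemma pow_ring_of_type_algebra [simp]:
  fixes a :: "'a :: comm_ring_1"
  shows "a [^]\<^bsub>ring_of_type_algebra\<^esub> (n :: nat) = a ^ n"
  by (induction n) (simp_all add: nat_pow_def mult.commute)

text \<open>Closure under negation comes for free, as multiplication by \<open>- 1\<close>. This
  lets ideals be checked with the type class operations alone.\<close>

lemma ideal_ring_of_type_algebra_iff:
  fixes J :: "'a :: comm_ring_1 set"
  shows "ideal J ring_of_type_algebra \<longleftrightarrow>
    0 \<in> J \<and> (\<forall>a\<in>J. \<forall>b\<in>J. a + b \<in> J) \<and> (\<forall>a\<in>J. \<forall>p. p * a \<in> J)"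
proof
  assume "ideal J ring_of_type_algebra"
  then interpret ideal J "ring_of_type_algebra :: 'a ring" .
  show "0 \<in> J \<and> (\<forall>a\<in>J. \<forall>b\<in>J. a + b \<in> J) \<and> (\<forall>a\<in>J. \<forall>p. p * a \<in> J)"
    using additive_subgroup.zero_closed[OF is_additive_subgroup]
      additive_subgroup.a_closed[OF is_additive_subgroup] I_l_closed by auto
next
  assume J: "0 \<in> J \<and> (\<forall>a\<in>J. \<forall>b\<in>J. a + b \<in> J) \<and> (\<forall>a\<in>J. \<forall>p. p * a \<in> J)"
  interpret R: cring "ring_of_type_algebra :: 'a ring" by (rule cring_from_type_algebra)
  show "ideal J ring_of_type_algebra"
  proof (rule idealI[OF R.ring_axioms])
    have neg: "- a \<in> J" if "a \<in> J" for a
      using J that by (metis mult_minus1)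
    have inv: "inv\<^bsub>add_monoid ring_of_type_algebra\<^esub> a = - a" for a :: 'a
      using minus_ring_of_type_algebra(1)[of a] by (simp only: a_inv_def)
    show "subgroup J (add_monoid ring_of_type_algebra)"
    proof (rule subgroup.intro)
      show "inv\<^bsub>add_monoid ring_of_type_algebra\<^esub> a \<in> J" if "a \<in> J" for a
        using neg[OF that] by (simp only: inv)
    qed (use J in auto)
  qed (use J in \<open>auto simp: mult.commute\<close>)
qed

context
  fixes J :: "'a :: comm_ring_1 set"
  assumes J: "ideal J ring_of_type_algebra"
begin

interpretation ideal J "ring_of_type_algebra :: 'a ring" by (rule J)

lemma ideal_zero [simp]: "0 \<in> J"
  and ideal_add: "a \<in> J \<Longrightarrow> b \<in> J \<Longrightarrow> a + b \<in> J"
  and ideal_mult: "a \<in> J \<Longrightarrow> p * a \<in> J"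
  using J by (simp_all add: ideal_ring_of_type_algebra_iff)

lemma ideal_uminus: "a \<in> J \<Longrightarrow> - a \<in> J"
  using ideal_mult[of a "- 1"] by simp

lemma ideal_diff: "a \<in> J \<Longrightarrow> b \<in> J \<Longrightarrow> a - b \<in> J"
  using ideal_add[of a "- b"] ideal_uminus[of b] by simp

lemma ideal_sum: "(\<And>x. x \<in> A \<Longrightarrow> f x \<in> J) \<Longrightarrow> sum f A \<in> J"
  by (induction A rule: infinite_finite_induct) (auto intro: ideal_add)

lemma coset_eq_iff:
  "J +>\<^bsub>ring_of_type_algebra\<^esub> f = J +>\<^bsub>ring_of_type_algebra\<^esub> g \<longleftrightarrow> f - g \<in> J"
  using quotient_eq_iff_same_a_r_cos[OF J, of f g] by simp

lemma quot_carrier: "carrier (ring_of_type_algebra Quot J) = range ((+>\<^bsub>ring_of_type_algebra\<^esub>) J)"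
  by (auto simp: FactRing_def A_RCOSETS_def')

lemma quot_simps:
  "(J +>\<^bsub>ring_of_type_algebra\<^esub> f) \<otimes>\<^bsub>ring_of_type_algebra Quot J\<^esub> (J +>\<^bsub>ring_of_type_algebra\<^esub> g)
    = J +>\<^bsub>ring_of_type_algebra\<^esub> (f * g)"
  "(J +>\<^bsub>ring_of_type_algebra\<^esub> f) \<oplus>\<^bsub>ring_of_type_algebra Quot J\<^esub> (J +>\<^bsub>ring_of_type_algebra\<^esub> g)
    = J +>\<^bsub>ring_of_type_algebra\<^esub> (f + g)"
  "\<one>\<^bsub>ring_of_type_algebra Quot J\<^esub> = J +>\<^bsub>ring_of_type_algebra\<^esub> 1"
  "\<zero>\<^bsub>ring_of_type_algebra Quot J\<^esub> = J +>\<^bsub>ring_of_type_algebra\<^esub> 0"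
  using ring_hom_mult[OF rcos_ring_hom] ring_hom_add[OF rcos_ring_hom] ring_hom_one[OF rcos_ring_hom]
    a_coset_add_zero[of J] a_subset
  by (auto simp: FactRing_def)

lemma quot_cring: "cring (ring_of_type_algebra Quot J)"
  by (rule quotient_is_cring) (rule cring_from_type_algebra)

end

section \<open>The \<open>K\<close>-space \<open>P/J\<close> and the images of subspaces of
  \<open>P\<close>\<close>

lemma const_poly_simps:
  "const_poly (a + b) = const_poly a + const_poly b"
  "const_poly (a * b) = const_poly a * const_poly b"
  "const_poly (- a) = - const_poly a"
  "const_poly 1 = 1"
  "const_poly 0 = 0"
  by (simp_all add: const_poly_def single_add mult_single single_uminus)

lemma quot_space_simps:
  "carrier (quot_space J) = carrier (mpoly_ring Quot J)"
  "\<zero>\<^bsub>quot_space J\<^esub> = \<zero>\<^bsub>mpoly_ring Quot J\<^esub>"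
  "(\<oplus>\<^bsub>quot_space J\<^esub>) = (\<oplus>\<^bsub>mpoly_ring Quot J\<^esub>)"
  "c \<odot>\<^bsub>quot_space J\<^esub> C = (J +>\<^bsub>mpoly_ring\<^esub> const_poly c) \<otimes>\<^bsub>mpoly_ring Quot J\<^esub> C"
  by (simp_all add: quot_space_def ring.defs module.defs)

lemma quot_space_vectorspace:
  fixes J :: "('x::finite, 'k::field) mpoly set"
  assumes J: "ideal J mpoly_ring"
  shows "vectorspace coeff_field (quot_space J)"
proof -
  interpret Q: cring "mpoly_ring Quot J" by (rule quot_cring[OF J])
  note s = quot_space_simps quot_carrier[OF J] quot_simps[OF J]
  have K: "field (coeff_field :: 'k ring)" by (rule field_from_type_algebra)
  have "module (coeff_field :: 'k ring) (quot_space J)"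
  proof (rule moduleI)
    show "cring (coeff_field :: 'k ring)" by (rule cring_from_type_algebra)
    show "abelian_group (quot_space J)"
      by (rule abelian_groupI)
        (auto simp: quot_space_simps Q.add.m_ac intro: Q.add.l_inv_ex)
  qed (auto simp: s const_poly_simps algebra_simps)
  with K show ?thesis by (simp add: vectorspace_def)
qed

text \<open>The \<open>K\<close>-subspaces of \<open>P\<close>, with scalars acting as constant
  polynomials. Their images are the subspaces of \<open>P/J\<close> whose dimensions are needed:
  those of ideals and of filtration steps.\<close>

definition lin_subspace :: "('x::finite, 'k::field) mpoly set \<Rightarrow> bool" where
  "lin_subspace S \<longleftrightarrow>
     0 \<in> S \<and> (\<forall>f\<in>S. \<forall>g\<in>S. f + g \<in> S) \<and> (\<forall>c. \<forall>f\<in>S. const_poly c * f \<in> S)"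

lemma lin_subspace_UNIV: "lin_subspace UNIV"
  by (simp add: lin_subspace_def)

lemma lin_subspace_zero: "lin_subspace {0}"
  by (simp add: lin_subspace_def)

lemma lin_subspace_ideal: "ideal J mpoly_ring \<Longrightarrow> lin_subspace J"
  by (simp add: lin_subspace_def ideal_ring_of_type_algebra_iff)

lemma lin_subspace_diff:
  assumes "lin_subspace S" "f \<in> S" "g \<in> S"
  shows "f - g \<in> S"
proof -
  have "const_poly (- 1) * g \<in> S" using assms by (simp only: lin_subspace_def)
  then have "- g \<in> S" by (simp add: const_poly_simps)
  with assms have "f + - g \<in> S" by (simp only: lin_subspace_def)
  then show ?thesis by simp
qed

context
  fixes J :: "('x::finite, 'k::field) mpoly set"
  assumes J: "ideal J mpoly_ring"
begin

interpretation V: vectorspace coeff_field "quot_space J" by (rule quot_space_vectorspace[OF J])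

lemma mem_quot_image_iff:
  "J +>\<^bsub>mpoly_ring\<^esub> f \<in> quot_image J S \<longleftrightarrow> (\<exists>s\<in>S. f - s \<in> J)"
  by (auto simp: quot_image_def coset_eq_iff[OF J])

lemma quot_image_submodule:
  assumes "lin_subspace S"
  shows "submodule coeff_field (quot_image J S) (quot_space J)"
  using assms unfolding quot_image_def lin_subspace_def
  by unfold_locales (auto simp: quot_space_simps quot_carrier[OF J] quot_simps[OF J])

lemma dim_K_vectorspace_dim:
  "dim_K J (carrier (mpoly_ring Quot J)) = vectorspace.dim coeff_field (quot_space J)"
  by (simp add: dim_K_def flip: quot_space_simps(1))

lemma dim_K_zero: "dim_K J (quot_image J {0}) = 0"
  using V.zero_submodule_dim
  by (simp add: dim_K_def quot_image_def quot_space_simps quot_simps[OF J])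

context
  assumes fin: "vectorspace.fin_dim coeff_field (quot_space J)"
begin

text \<open>In finite dimension only the whole space has full dimension; on representatives this
  reads \<open>S + J = P\<close>.\<close>

lemma dim_K_eq_full_iff:
  assumes S: "lin_subspace S"
  shows "dim_K J (quot_image J S) = dim_K J (carrier (mpoly_ring Quot J)) \<longleftrightarrow>
    (\<forall>f. \<exists>s\<in>S. f - s \<in> J)"
proof
  assume "dim_K J (quot_image J S) = dim_K J (carrier (mpoly_ring Quot J))"
  then have "quot_image J S = carrier (quot_space J)"
    using V.submodule_eq_carrier_if_dim_eq[OF fin quot_image_submodule[OF S]]
    by (simp only: dim_K_vectorspace_dim dim_K_def[of J "quot_image J S"])
  then have "J +>\<^bsub>mpoly_ring\<^esub> f \<in> quot_image J S" for f
    by (simp add: quot_space_simps quot_carrier[OF J])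
  then show "\<forall>f. \<exists>s\<in>S. f - s \<in> J" by (simp add: mem_quot_image_iff)
next
  assume "\<forall>f. \<exists>s\<in>S. f - s \<in> J"
  then have "range ((+>\<^bsub>mpoly_ring\<^esub>) J) \<subseteq> quot_image J S"
    using mem_quot_image_iff by blast
  then have "quot_image J S = carrier (mpoly_ring Quot J)"
    by (auto simp: quot_image_def quot_carrier[OF J])
  then show "dim_K J (quot_image J S) = dim_K J (carrier (mpoly_ring Quot J))" by simp
qed

lemma dim_K_eq_Suc_iff:
  assumes S: "lin_subspace S" and T: "lin_subspace T" and "S \<subseteq> T"
  shows "dim_K J (quot_image J T) = Suc (dim_K J (quot_image J S)) \<longleftrightarrow>
    (\<exists>c\<in>T. (\<forall>s\<in>S. c - s \<notin> J) \<and> (\<forall>t\<in>T. \<exists>a. \<exists>s\<in>S. t - (const_poly a * c + s) \<in> J))"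
proof -
  note sT = quot_image_submodule[OF T]
  interpret W: vectorspace coeff_field "quot_space J\<lparr>carrier := quot_image J T\<rparr>"
    by (rule V.submodule_vectorspace[OF sT])
  \<comment> \<open>The codimension is measured inside the image of \<open>T\<close>, so the image
    of \<open>S\<close> has to be a subspace of that space and not just of
    \<open>P/J\<close>.\<close>
  have "submodule coeff_field (quot_image J S) (quot_space J\<lparr>carrier := quot_image J T\<rparr>)"
    using quot_image_submodule[OF S] \<open>S \<subseteq> T\<close> W.module_axioms
    by (auto simp: submodule_def quot_image_def)
  from W.dim_eq_Suc_submodule_iff[OF V.submodule_fin_dim[OF fin sT] this]
  have "dim_K J (quot_image J T) = Suc (dim_K J (quot_image J S)) \<longleftrightarrow>
    (\<exists>c\<in>quot_image J T - quot_image J S. \<forall>v\<in>quot_image J T.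
       \<exists>a\<in>carrier coeff_field. \<exists>u\<in>quot_image J S. v = a \<odot>\<^bsub>quot_space J\<^esub> c \<oplus>\<^bsub>quot_space J\<^esub> u)"
    by (simp add: dim_K_def)
  also have "\<dots> \<longleftrightarrow> (\<exists>c\<in>T. (\<forall>s\<in>S. c - s \<notin> J) \<and>
      (\<forall>t\<in>T. \<exists>a. \<exists>s\<in>S. t - (const_poly a * c + s) \<in> J))"
  proof -
    have ex: "(\<exists>c\<in>quot_image J T - quot_image J S. P c) \<longleftrightarrow>
      (\<exists>c\<in>T. (\<forall>s\<in>S. c - s \<notin> J) \<and> P (J +>\<^bsub>mpoly_ring\<^esub> c))" for P
    proof -
      have "(\<exists>c\<in>quot_image J T - quot_image J S. P c) \<longleftrightarrow>
        (\<exists>c\<in>T. J +>\<^bsub>mpoly_ring\<^esub> c \<notin> quot_image J S \<and> P (J +>\<^bsub>mpoly_ring\<^esub> c))"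
        unfolding quot_image_def[of J T] by blast
      then show ?thesis by (simp add: mem_quot_image_iff)
    qed
    have all: "(\<forall>c\<in>quot_image J T. P c) \<longleftrightarrow> (\<forall>c\<in>T. P (J +>\<^bsub>mpoly_ring\<^esub> c))"
      "(\<exists>c\<in>quot_image J S. P c) \<longleftrightarrow> (\<exists>c\<in>S. P (J +>\<^bsub>mpoly_ring\<^esub> c))" for P
      by (auto simp: quot_image_def)
    show ?thesis
      unfolding ex all by (simp add: quot_space_simps quot_simps[OF J] coset_eq_iff[OF J])
  qed
  finally show ?thesis .
qed

lemma dim_K_eq_1_iff:
  assumes T: "lin_subspace T"
  shows "dim_K J (quot_image J T) = 1 \<longleftrightarrow>
    (\<exists>c\<in>T. c \<notin> J \<and> (\<forall>t\<in>T. \<exists>a. t - const_poly a * c \<in> J))"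
  using dim_K_eq_Suc_iff[OF lin_subspace_zero T] T
  by (simp add: dim_K_zero lin_subspace_def)

end

end


section \<open>Homogeneous components and degree forms\<close>

lemma mpoly_sum_monomials:
  "(\<Sum>t\<in>Poly_Mapping.keys f. Poly_Mapping.single t (Poly_Mapping.lookup f t)) = f"
  by (rule poly_mapping_eqI)
    (simp add: lookup_sum lookup_single when_def in_keys_iff sum.delta cong: if_cong)

lemma mon_deg_add: "mon_deg (s + t) = mon_deg s + mon_deg t"
  by (simp add: mon_deg_def lookup_add sum.distrib)

lemma mon_deg_eq_0_iff: "mon_deg t = 0 \<longleftrightarrow> t = 0"
  by (auto simp: mon_deg_def intro: poly_mapping_eqI)

definition hom_comp :: "nat \<Rightarrow> ('x::finite, 'k::field) mpoly \<Rightarrow> ('x, 'k) mpoly" where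
  "hom_comp i f = Poly_Mapping.mapp (\<lambda>t c. c when mon_deg t = i) f"

lemma lookup_hom_comp:
  "Poly_Mapping.lookup (hom_comp i f) t = (Poly_Mapping.lookup f t when mon_deg t = i)"
  by (auto simp: hom_comp_def lookup_mapp when_def in_keys_iff)

lemma hom_comp_zero [simp]: "hom_comp i 0 = 0"
  and hom_comp_add: "hom_comp i (f + g) = hom_comp i f + hom_comp i g"
  and hom_comp_diff: "hom_comp i (f - g) = hom_comp i f - hom_comp i g"
  and hom_comp_hom_comp: "hom_comp i (hom_comp j f) = (hom_comp i f when i = j)"
  and hom_comp_single:
    "hom_comp i (Poly_Mapping.single t c) = (Poly_Mapping.single t c when mon_deg t = i)"
  by (rule poly_mapping_eqI;
      auto simp: lookup_hom_comp lookup_add lookup_minus lookup_single when_def)+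

lemma hom_comp_sum: "hom_comp i (sum f A) = (\<Sum>x\<in>A. hom_comp i (f x))"
  by (induction A rule: infinite_finite_induct) (simp_all add: hom_comp_add)

text \<open>Both sides are bilinear in \<open>f\<close> and \<open>g\<close>, so monomials suffice.
  For these only the summand with \<open>i\<close> equal to the degree of the first factor can be
  non-zero.\<close>

lemma hom_comp_mult: "hom_comp k (f * g) = (\<Sum>i\<le>k. hom_comp i f * hom_comp (k - i) g)"
proof -
  have single: "hom_comp k (Poly_Mapping.single s c * Poly_Mapping.single t d) =
    (\<Sum>i\<le>k. hom_comp i (Poly_Mapping.single s c) * hom_comp (k - i) (Poly_Mapping.single t d))"
    for s t :: "'a \<Rightarrow>\<^sub>0 nat" and c d :: 'b
  proof -
    have "(\<Sum>i\<le>k. hom_comp i (Poly_Mapping.single s c) * hom_comp (k - i) (Poly_Mapping.single t d)) =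
      (\<Sum>i\<le>k. if mon_deg s = i then
        Poly_Mapping.single s c * hom_comp (k - mon_deg s) (Poly_Mapping.single t d) else 0)"
      by (rule sum.cong) (auto simp: hom_comp_single)
    also have "\<dots> = hom_comp k (Poly_Mapping.single s c * Poly_Mapping.single t d)"
      by (auto simp: sum.delta hom_comp_single mult_single mon_deg_add when_def)
    finally show ?thesis ..
  qed
  let ?m = "\<lambda>f t. Poly_Mapping.single t (Poly_Mapping.lookup f t)"
  have "hom_comp k (f * g) =
    hom_comp k ((\<Sum>s\<in>Poly_Mapping.keys f. ?m f s) * (\<Sum>t\<in>Poly_Mapping.keys g. ?m g t))"
    by (simp only: mpoly_sum_monomials)
  also have "\<dots> = (\<Sum>s\<in>Poly_Mapping.keys f. \<Sum>t\<in>Poly_Mapping.keys g.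
      \<Sum>i\<le>k. hom_comp i (?m f s) * hom_comp (k - i) (?m g t))"
    by (simp only: sum_product hom_comp_sum single)
  also have "\<dots> = (\<Sum>i\<le>k. \<Sum>s\<in>Poly_Mapping.keys f. \<Sum>t\<in>Poly_Mapping.keys g.
      hom_comp i (?m f s) * hom_comp (k - i) (?m g t))"
    by (subst sum.swap[of _ "{..k}"], subst sum.swap[of _ "{..k}"], rule refl)
  also have "\<dots> = (\<Sum>i\<le>k. hom_comp i (\<Sum>s\<in>Poly_Mapping.keys f. ?m f s) *
      hom_comp (k - i) (\<Sum>t\<in>Poly_Mapping.keys g. ?m g t))"
    by (simp only: sum_product hom_comp_sum)
  finally show ?thesis by (simp only: mpoly_sum_monomials)
qed

lemma hom_comp_const_poly: "hom_comp i (const_poly c) = (const_poly c when i = 0)"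
  by (auto simp: const_poly_def hom_comp_single mon_deg_def when_def)

lemma hom_comp_const_mult: "hom_comp i (const_poly c * f) = const_poly c * hom_comp i f"
proof -
  have "hom_comp i (const_poly c * f) =
      (\<Sum>j\<le>i. if j = 0 then const_poly c * hom_comp i f else 0)"
    unfolding hom_comp_mult by (rule sum.cong) (auto simp: hom_comp_const_poly)
  then show ?thesis by (simp add: sum.delta)
qed

section \<open>The degree filtration in terms of homogeneous components\<close>

lemma mem_filt_P_iff_keys: "f \<in> filt_P i \<longleftrightarrow> (\<forall>t\<in>Poly_Mapping.keys f. int (mon_deg t) \<le> i)"
proof (cases "f = 0")
  case False
  then have "Poly_Mapping.keys f \<noteq> {}" by (auto simp: keys_eq_empty)
  \<comment> \<open>For negative \<open>i\<close> both sides are false, since a non-zero polynomial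
    has a power product; \<open>nat i\<close> may then stand in for \<open>i\<close> in the
    maximum.\<close>
  then have "int (tot_deg f) \<le> i \<longleftrightarrow> (\<forall>t\<in>Poly_Mapping.keys f. int (mon_deg t) \<le> i)"
  proof -
    have "int (tot_deg f) \<le> i \<longleftrightarrow> tot_deg f \<le> nat i \<and> i \<ge> 0" by auto
    also have "\<dots> \<longleftrightarrow> (\<forall>t\<in>Poly_Mapping.keys f. mon_deg t \<le> nat i \<and> i \<ge> 0)"
      using \<open>Poly_Mapping.keys f \<noteq> {}\<close> by (auto simp: tot_deg_def simp del: keys_eq_empty)
    also have "\<dots> \<longleftrightarrow> (\<forall>t\<in>Poly_Mapping.keys f. int (mon_deg t) \<le> i)" by auto
    finally show ?thesis .
  qed
  with False show ?thesis by (simp add: filt_P_def)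
qed (simp add: filt_P_def)

lemma mem_filt_P_iff: "f \<in> filt_P i \<longleftrightarrow> (\<forall>j. i < int j \<longrightarrow> hom_comp j f = 0)"
proof
  assume "f \<in> filt_P i"
  then show "\<forall>j. i < int j \<longrightarrow> hom_comp j f = 0"
    unfolding mem_filt_P_iff_keys
    by (intro allI impI poly_mapping_eqI) (force simp: lookup_hom_comp when_def in_keys_iff)
next
  assume *: "\<forall>j. i < int j \<longrightarrow> hom_comp j f = 0"
  show "f \<in> filt_P i"
    unfolding mem_filt_P_iff_keys
  proof
    fix t assume "t \<in> Poly_Mapping.keys f"
    then have "Poly_Mapping.lookup (hom_comp (mon_deg t) f) t \<noteq> 0"
      by (simp add: lookup_hom_comp in_keys_iff)
    then have "hom_comp (mon_deg t) f \<noteq> 0" by auto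
    with * show "int (mon_deg t) \<le> i" by force
  qed
qed

lemma ex_filt_P: "\<exists>n. f \<in> filt_P (int n)"
proof -
  have "f \<in> filt_P (int (Max (insert 0 (mon_deg ` Poly_Mapping.keys f))))"
    by (auto simp: mem_filt_P_iff_keys)
  then show ?thesis ..
qed

lemma filt_P_mono: "i \<le> j \<Longrightarrow> filt_P i \<subseteq> filt_P j"
  by (auto simp: mem_filt_P_iff)

lemma lin_subspace_filt_P: "lin_subspace (filt_P i)"
  by (auto simp: lin_subspace_def mem_filt_P_iff hom_comp_add hom_comp_const_mult)

lemma hom_comp_in_filt_P: "hom_comp i f \<in> filt_P (int i)"
  by (auto simp: mem_filt_P_iff hom_comp_hom_comp when_def)

lemma sum_hom_comp:
  assumes "f \<in> filt_P (int n)"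
  shows "(\<Sum>i\<le>n. hom_comp i f) = f"
proof (rule poly_mapping_eqI)
  fix t
  have "Poly_Mapping.lookup f t = 0" if "n < mon_deg t"
    using assms that unfolding mem_filt_P_iff_keys by (force simp: in_keys_iff)
  then show "Poly_Mapping.lookup (\<Sum>i\<le>n. hom_comp i f) t = Poly_Mapping.lookup f t"
    by (auto simp: lookup_sum lookup_hom_comp when_def sum.delta)
qed

text \<open>The index \<open>int n - 1\<close> is an integer, so \<open>n = 0\<close> is covered:
  there \<open>filt_P (- 1)\<close> contains only \<open>0\<close>.\<close>

lemma filt_P_minus_one_iff:
  "f \<in> filt_P (int n - 1) \<longleftrightarrow> f \<in> filt_P (int n) \<and> hom_comp n f = 0"
proof -
  have "int n - 1 < int j \<longleftrightarrow> int n < int j \<or> j = n" for j by auto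
  then show ?thesis by (auto simp: mem_filt_P_iff)
qed

lemma degree_form_eq_hom_comp:
  assumes "f \<in> filt_P (int i)" "hom_comp i f \<noteq> 0"
  shows "degree_form f = hom_comp i f" "f \<noteq> 0"
proof -
  obtain t where t: "Poly_Mapping.lookup (hom_comp i f) t \<noteq> 0"
    using assms(2) by (metis lookup_zero poly_mapping_eqI)
  then have t: "t \<in> Poly_Mapping.keys f" "mon_deg t = i"
    by (auto simp: lookup_hom_comp in_keys_iff when_def split: if_splits)
  then have "tot_deg f = i"
    unfolding tot_deg_def using assms(1)
    by (intro Max_eqI) (auto simp: mem_filt_P_iff_keys)
  then show "degree_form f = hom_comp i f"
    by (intro poly_mapping_eqI)
      (auto simp: degree_form_def lookup_sum lookup_hom_comp lookup_single when_def in_keys_iff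
        sum.delta cong: if_cong)
  show "f \<noteq> 0" using assms(2) by auto
qed

text \<open>The degree \<open>i\<close> part of \<open>DF(J)\<close>, described without reference to generators.\<close>

definition lead :: "('x::finite, 'k::field) mpoly set \<Rightarrow> nat \<Rightarrow> ('x, 'k) mpoly set" where
  "lead J i = hom_comp i ` (J \<inter> filt_P (int i))"

section \<open>The degree form ideal through the leading forms of \<open>J\<close>\<close>

context
  fixes J :: "('x::finite, 'k::field) mpoly set"
  assumes J: "ideal J mpoly_ring"
begin

lemma lin_subspace_lead: "lin_subspace (lead J i)"
proof -
  have "lin_subspace (J \<inter> filt_P (int i))"
    using lin_subspace_ideal[OF J] lin_subspace_filt_P[of "int i"]
    by (auto simp: lin_subspace_def)
  then show ?thesis
    unfolding lead_def lin_subspace_def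
    by (auto simp flip: hom_comp_add hom_comp_const_mult intro!: imageI image_eqI[of 0 _ 0])
qed

lemma lead_sum: "(\<And>x. x \<in> A \<Longrightarrow> f x \<in> lead J i) \<Longrightarrow> sum f A \<in> lead J i"
  using lin_subspace_lead[of i]
  by (induction A rule: infinite_finite_induct) (auto simp: lin_subspace_def)

text \<open>If \<open>l\<close> is the leading part of \<open>g\<close> in \<open>J\<close>, then
  \<open>hom_comp i p * g\<close> is an element of \<open>J\<close> of degree at most
  \<open>i + j\<close> whose component of degree \<open>i + j\<close> is the required
  product.\<close>

lemma lead_mult:
  assumes "l \<in> lead J j"
  shows "hom_comp i p * l \<in> lead J (i + j)"
proof -
  obtain g where g: "g \<in> J" "g \<in> filt_P (int j)" "l = hom_comp j g"
    using assms by (auto simp: lead_def)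
  have comp: "hom_comp k (hom_comp i p * g) =
      (if i \<le> k then hom_comp i p * hom_comp (k - i) g else 0)" for k
  proof -
    have "hom_comp k (hom_comp i p * g) =
        (\<Sum>m\<le>k. if m = i then hom_comp i p * hom_comp (k - i) g else 0)"
      unfolding hom_comp_mult by (rule sum.cong) (auto simp: hom_comp_hom_comp)
    then show ?thesis by (simp add: sum.delta)
  qed
  have "hom_comp (k - i) g = 0" if "int (i + j) < int k" for k
    using g(2) that by (auto simp: mem_filt_P_iff)
  then have "hom_comp i p * g \<in> filt_P (int (i + j))"
    unfolding mem_filt_P_iff comp by auto
  moreover have "hom_comp i p * g \<in> J" using g J by (simp add: ideal_mult)
  moreover have "hom_comp (i + j) (hom_comp i p * g) = hom_comp i p * l"
    by (simp add: comp g(3))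
  ultimately show ?thesis unfolding lead_def by (metis IntI imageI)
qed

lemma ideal_DF: "ideal (DF J) mpoly_ring"
proof -
  interpret R: cring "mpoly_ring :: ('x, 'k) mpoly ring" by (rule cring_from_type_algebra)
  show ?thesis unfolding DF_def by (rule R.genideal_ideal) simp
qed

text \<open>The polynomials with all components in \<open>lead J\<close> form an ideal containing
  every degree form, hence containing \<open>DF J\<close>. Conversely, a non-zero component in
  \<open>lead J i\<close> is itself a degree form of an element of \<open>J\<close>, and a
  polynomial is the sum of its components.\<close>

lemma mem_DF_iff: "f \<in> DF J \<longleftrightarrow> (\<forall>i. hom_comp i f \<in> lead J i)"
proof
  interpret R: cring "mpoly_ring :: ('x, 'k) mpoly ring" by (rule cring_from_type_algebra)
  let ?D = "{f. \<forall>i. hom_comp i f \<in> lead J i}"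
  have "ideal ?D mpoly_ring"
    unfolding ideal_ring_of_type_algebra_iff
  proof (intro conjI ballI allI)
    show "0 \<in> ?D" using lin_subspace_lead by (simp add: lin_subspace_def)
    show "a + b \<in> ?D" if "a \<in> ?D" "b \<in> ?D" for a b
      using lin_subspace_lead that by (auto simp: lin_subspace_def hom_comp_add)
    fix a p assume a: "a \<in> ?D"
    have "hom_comp j p * hom_comp (i - j) a \<in> lead J i" if "j \<le> i" for i j
      using lead_mult[of "hom_comp (i - j) a" "i - j" j p] a that by simp
    then show "p * a \<in> ?D" by (auto simp: hom_comp_mult intro!: lead_sum)
  qed
  moreover have "degree_form ` (J - {0}) \<subseteq> ?D"
  proof safe
    fix g i assume g: "g \<in> J" "g \<noteq> 0"
    have gd: "g \<in> filt_P (int (tot_deg g))" using g by (simp add: filt_P_def)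
    have "Poly_Mapping.keys g \<noteq> {}" using g by (auto simp: keys_eq_empty)
    then have "tot_deg g \<in> mon_deg ` Poly_Mapping.keys g"
      unfolding tot_deg_def by (intro Max_in) auto
    then obtain t where "t \<in> Poly_Mapping.keys g" "mon_deg t = tot_deg g" by auto
    then have "Poly_Mapping.lookup (hom_comp (tot_deg g) g) t \<noteq> 0"
      by (simp add: lookup_hom_comp in_keys_iff)
    then have nz: "hom_comp (tot_deg g) g \<noteq> 0" by auto
    have "0 \<in> lead J i" using lin_subspace_lead by (simp add: lin_subspace_def)
    then show "hom_comp i (degree_form g) \<in> lead J i"
      using g gd degree_form_eq_hom_comp[OF gd nz]
      by (cases "i = tot_deg g") (auto simp: hom_comp_hom_comp lead_def)
  qed
  ultimately have "DF J \<subseteq> ?D"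
    unfolding DF_def by (intro R.genideal_minimal)
  then show "\<forall>i. hom_comp i f \<in> lead J i" if "f \<in> DF J" using that by auto
next
  interpret R: cring "mpoly_ring :: ('x, 'k) mpoly ring" by (rule cring_from_type_algebra)
  assume f: "\<forall>i. hom_comp i f \<in> lead J i"
  have gen: "degree_form ` (J - {0}) \<subseteq> DF J"
    unfolding DF_def by (rule R.genideal_self) simp
  have "hom_comp i f \<in> DF J" for i
  proof (cases "hom_comp i f = 0")
    case False
    obtain g where g: "g \<in> J" "g \<in> filt_P (int i)" "hom_comp i f = hom_comp i g"
      using f by (auto simp: lead_def)
    with False degree_form_eq_hom_comp[of g i] gen show ?thesis by auto
  qed (simp add: ideal_DF)
  moreover obtain n where "f \<in> filt_P (int n)" using ex_filt_P by blast
  ultimately show "f \<in> DF J"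
    using sum_hom_comp[of f n] ideal_sum[OF ideal_DF, of "{..n}" "\<lambda>i. hom_comp i f"] by simp
qed

lemma lead_subset_DF: "lead J i \<subseteq> DF J"
proof
  fix l assume l: "l \<in> lead J i"
  then have "hom_comp j l = (l when j = i)" for j
    by (auto simp: lead_def hom_comp_hom_comp when_def)
  then show "l \<in> DF J"
    using l lin_subspace_lead by (auto simp: mem_DF_iff when_def lin_subspace_def)
qed

text \<open>Elements of \<open>lead J i\<close> are homogeneous and lie in \<open>DF J\<close>, so
  they are their own leading parts. Thus passing to the graded ring changes neither the top degree
  nor the part in that degree.\<close>

lemma lead_DF: "lead (DF J) i = lead J i"
proof
  show "lead (DF J) i \<subseteq> lead J i"
    by (auto simp: lead_def[of "DF J"] mem_DF_iff)
  show "lead J i \<subseteq> lead (DF J) i"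
  proof
    fix l assume l: "l \<in> lead J i"
    then have "l \<in> filt_P (int i)" "hom_comp i l = l"
      by (auto simp: lead_def hom_comp_hom_comp hom_comp_in_filt_P)
    with l lead_subset_DF show "l \<in> lead (DF J) i"
      unfolding lead_def[of "DF J"] by (metis IntI imageI subsetD)
  qed
qed

end


section \<open>The top degree of the graded ring\<close>

lemma finite_mon_deg_le: "finite {t :: 'x::finite \<Rightarrow>\<^sub>0 nat. mon_deg t \<le> n}"
proof (rule inj_on_finite)
  show "inj_on Poly_Mapping.lookup {t :: 'x \<Rightarrow>\<^sub>0 nat. mon_deg t \<le> n}"
    by (auto simp: inj_on_def intro: poly_mapping_eqI)
  have "Poly_Mapping.lookup t x \<le> n" if "mon_deg t \<le> n" for t and x :: 'x
    using member_le_sum[of x UNIV "Poly_Mapping.lookup t"] that by (simp add: mon_deg_def)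
  then show "Poly_Mapping.lookup ` {t :: 'x \<Rightarrow>\<^sub>0 nat. mon_deg t \<le> n} \<subseteq> PiE UNIV (\<lambda>_. {..n})"
    by auto
  show "finite (PiE (UNIV :: 'x set) (\<lambda>_. {..n}))" by (rule finite_PiE) auto
qed

text \<open>This says that \<open>r\<close> is the top degree in which the graded ring \<open>P/DF(J)\<close> is non-zero.\<close>

definition top_degree :: "('x::finite, 'k::field) mpoly set \<Rightarrow> nat \<Rightarrow> bool" where
  "top_degree J r \<longleftrightarrow>
     (\<forall>i>r. \<forall>f. hom_comp i f \<in> lead J i) \<and> (\<exists>f. hom_comp r f \<notin> lead J r)"

text \<open>A finite generating set has representatives of bounded degree, and so has its span.
  Conversely, there are only finitely many power products of degree at most
  \<open>n\<close>.\<close>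

lemma quot_fin_dim_iff:
  fixes J :: "('x::finite, 'k::field) mpoly set"
  assumes J: "ideal J mpoly_ring"
  shows "vectorspace.fin_dim coeff_field (quot_space J) \<longleftrightarrow>
    (\<exists>n. \<forall>f. \<exists>s\<in>filt_P (int n). f - s \<in> J)"
proof -
  interpret V: vectorspace coeff_field "quot_space J" by (rule quot_space_vectorspace[OF J])
  show ?thesis
  proof
    assume "V.fin_dim"
    then obtain A where A: "finite A" "A \<subseteq> carrier (quot_space J)"
      "V.span A = carrier (quot_space J)"
      by (auto simp: V.fin_dim_def)
    have "\<exists>n. A \<subseteq> quot_image J (filt_P (int n))"
      using A(1,2)
    proof (induction A rule: finite_induct)
      case (insert C A)
      then obtain n where n: "A \<subseteq> quot_image J (filt_P (int n))" by auto
      obtain f where f: "C = J +>\<^bsub>mpoly_ring\<^esub> f"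
        using insert by (auto simp: quot_space_simps quot_carrier[OF J])
      obtain m where "f \<in> filt_P (int m)" using ex_filt_P by blast
      then have "C \<in> quot_image J (filt_P (int (max m n)))"
        using filt_P_mono[of "int m" "int (max m n)"] unfolding f quot_image_def by auto
      moreover have "A \<subseteq> quot_image J (filt_P (int (max m n)))"
        using n filt_P_mono[of "int n" "int (max m n)"] unfolding quot_image_def by auto
      ultimately show ?case by blast
    qed simp
    then obtain n where n: "A \<subseteq> quot_image J (filt_P (int n))" ..
    have "carrier (quot_space J) \<subseteq> quot_image J (filt_P (int n))"
      using V.span_is_subset[OF n quot_image_submodule[OF J lin_subspace_filt_P]] A(3) by simp
    then have "J +>\<^bsub>mpoly_ring\<^esub> f \<in> quot_image J (filt_P (int n))" for f
      by (auto simp: quot_space_simps quot_carrier[OF J])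
    then show "\<exists>n. \<forall>f. \<exists>s\<in>filt_P (int n). f - s \<in> J"
      by (auto simp: mem_quot_image_iff[OF J])
  next
    assume "\<exists>n. \<forall>f. \<exists>s\<in>filt_P (int n). f - s \<in> J"
    then obtain n where n: "\<And>f. \<exists>s\<in>filt_P (int n). f - s \<in> J" by blast
    \<comment> \<open>The power products of degree at most \<open>n\<close>, whose classes will span
      \<open>P/J\<close>.\<close>
    define M :: "('x, 'k) mpoly set" where
      "M = (\<lambda>t. Poly_Mapping.single t 1) ` {t. mon_deg t \<le> n}"
    let ?c = "(+>\<^bsub>mpoly_ring\<^esub>) J"
    have sub: "?c ` M \<subseteq> carrier (quot_space J)"
      by (auto simp: quot_space_simps quot_carrier[OF J])
    have W: "submodule coeff_field (V.span (?c ` M)) (quot_space J)"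
      by (rule V.span_is_submodule[OF sub])
    have sum: "?c (\<Sum>t\<in>T. g t) \<in> V.span (?c ` M)"
      if "finite T" "\<And>t. t \<in> T \<Longrightarrow> ?c (g t) \<in> V.span (?c ` M)"
      for T and g :: "('x \<Rightarrow>\<^sub>0 nat) \<Rightarrow> ('x, 'k) mpoly"
      using that W
    proof (induction T rule: finite_induct)
      case empty
      then show ?case by (simp add: submodule_def quot_space_simps quot_simps[OF J])
    next
      case (insert t T)
      have "?c (g t) \<oplus>\<^bsub>quot_space J\<^esub> ?c (\<Sum>t\<in>T. g t) \<in> V.span (?c ` M)"
        using insert by (auto simp: submodule_def)
      then show ?case
        using insert by (simp add: quot_space_simps quot_simps[OF J])
    qed
    have mono: "?c (Poly_Mapping.single t a) \<in> V.span (?c ` M)" if "mon_deg t \<le> n" for t a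
    proof -
      have "?c (Poly_Mapping.single t 1) \<in> V.span (?c ` M)"
        using V.in_own_span[OF sub] that by (auto simp: M_def)
      then have "a \<odot>\<^bsub>quot_space J\<^esub> ?c (Poly_Mapping.single t 1) \<in> V.span (?c ` M)"
        using W by (auto simp: submodule_def)
      then show ?thesis
        by (simp add: quot_space_simps quot_simps[OF J] const_poly_def mult_single)
    qed
    have span: "?c f \<in> V.span (?c ` M)" for f
    proof -
      obtain s where s: "s \<in> filt_P (int n)" "f - s \<in> J" using n by blast
      have "?c (\<Sum>t\<in>Poly_Mapping.keys s. Poly_Mapping.single t (Poly_Mapping.lookup s t))
          \<in> V.span (?c ` M)"
        using s(1) by (intro sum mono) (auto simp: mem_filt_P_iff_keys)
      then show ?thesis using s(2) by (simp only: mpoly_sum_monomials coset_eq_iff[OF J, symmetric])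
    qed
    have "V.span (?c ` M) = carrier (quot_space J)"
      using V.span_is_subset2[OF sub] span
      by (auto simp: quot_space_simps quot_carrier[OF J])
    moreover have "finite (?c ` M)" by (simp add: M_def finite_mon_deg_le)
    ultimately show "V.fin_dim" using sub by (auto simp: V.fin_dim_def)
  qed
qed

lemma ex_top_degree:
  fixes J :: "('x::finite, 'k::field) mpoly set"
  assumes "zero_dim_ideal J"
  shows "\<exists>r. top_degree J r"
proof -
  have J: "ideal J mpoly_ring" "1 \<notin> J"
    and fin: "vectorspace.fin_dim coeff_field (quot_space J)"
    using assms ideal.one_imp_carrier[of J mpoly_ring] by (auto simp: zero_dim_ideal_def)
  obtain n where n: "\<And>f. \<exists>s\<in>filt_P (int n). f - s \<in> J"
    using fin quot_fin_dim_iff[OF J(1)] by blast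
  have big: "hom_comp i f \<in> lead J i" if i: "n < i" for i f
  proof -
    \<comment> \<open>Since \<open>i\<close> exceeds \<open>n\<close>, subtracting \<open>s\<close>
      leaves the degree \<open>i\<close> part unchanged, so that part is the leading part of an
      element of \<open>J\<close>.\<close>
    obtain s where s: "s \<in> filt_P (int n)" "hom_comp i f - s \<in> J" using n by blast
    have "hom_comp i f - s \<in> filt_P (int i)"
      using lin_subspace_diff[OF lin_subspace_filt_P hom_comp_in_filt_P] s(1) i
        filt_P_mono[of "int n" "int i"] by auto
    moreover have "hom_comp i (hom_comp i f - s) = hom_comp i f"
      using s(1) i by (auto simp: hom_comp_diff hom_comp_hom_comp mem_filt_P_iff)
    ultimately show ?thesis using s(2) unfolding lead_def by (metis IntI imageI)
  qed
  define B where "B = {i. \<exists>f. hom_comp i f \<notin> lead J i}"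
  have "B \<subseteq> {..n}" using big by (force simp: B_def not_less)
  then have "finite B" by (rule finite_subset) simp
  \<comment> \<open>Degree \<open>0\<close> survives: a constant in \<open>J\<close> with degree
    \<open>0\<close> part \<open>1\<close> would be \<open>1\<close> itself, and \<open>J\<close> is
    proper.\<close>
  have "hom_comp 0 1 \<notin> lead J 0"
  proof
    assume "hom_comp 0 1 \<in> lead J 0"
    then obtain g where g: "g \<in> J" "g \<in> filt_P (int 0)" "hom_comp 0 1 = hom_comp 0 g"
      by (auto simp: lead_def)
    have "hom_comp 0 (const_poly 1 :: ('x, 'k) mpoly) = 1"
      using hom_comp_const_poly[of 0 1] by (simp add: const_poly_simps)
    then have "g = 1" using g(3) sum_hom_comp[OF g(2)] by (simp add: const_poly_simps)
    with g J show False by simp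
  qed
  then have "0 \<in> B" by (auto simp: B_def)
  then have "Max B \<in> B" using \<open>finite B\<close> by (intro Max_in) auto
  moreover have "\<forall>i>Max B. i \<notin> B"
    using Max_ge[OF \<open>finite B\<close>] by (meson leD)
  moreover have "top_degree J m \<longleftrightarrow> (\<forall>i>m. i \<notin> B) \<and> m \<in> B" for m
    by (simp add: top_degree_def B_def)
  ultimately show ?thesis by blast
qed

lemma top_degree_DF: "ideal J mpoly_ring \<Longrightarrow> top_degree (DF J) r \<longleftrightarrow> top_degree J r"
  by (simp only: top_degree_def lead_DF)

section \<open>Regularity index, last difference and orders in terms of the top degree\<close>

context
  fixes J :: "('x::finite, 'k::field) mpoly set" and r :: nat
  assumes J: "ideal J mpoly_ring" and r: "top_degree J r"
begin

text \<open>The link between \<open>P/J\<close> and its graded ring: the degree of \<open>f\<close>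
  can be lowered modulo \<open>J\<close> exactly when some element of \<open>J\<close> of degree at
  most \<open>n\<close> cancels its degree \<open>n\<close> part.\<close>

lemma mem_filt_P_plus_ideal_iff:
  assumes "f \<in> filt_P (int n)"
  shows "(\<exists>s\<in>filt_P (int n - 1). f - s \<in> J) \<longleftrightarrow> hom_comp n f \<in> lead J n"
proof
  assume "\<exists>s\<in>filt_P (int n - 1). f - s \<in> J"
  then obtain s where s: "s \<in> filt_P (int n)" "hom_comp n s = 0" "f - s \<in> J"
    by (auto simp: filt_P_minus_one_iff)
  have "f - s \<in> filt_P (int n)" by (rule lin_subspace_diff[OF lin_subspace_filt_P assms s(1)])
  moreover have "hom_comp n f = hom_comp n (f - s)" by (simp add: hom_comp_diff s(2))
  ultimately show "hom_comp n f \<in> lead J n" using s(3) by (auto simp: lead_def)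
next
  assume "hom_comp n f \<in> lead J n"
  then obtain g where g: "g \<in> J" "g \<in> filt_P (int n)" "hom_comp n f = hom_comp n g"
    by (auto simp: lead_def)
  have "f - g \<in> filt_P (int n - 1)"
    unfolding filt_P_minus_one_iff
    using lin_subspace_diff[OF lin_subspace_filt_P assms g(2)] by (simp add: hom_comp_diff g(3))
  with g(1) show "\<exists>s\<in>filt_P (int n - 1). f - s \<in> J" by (intro bexI[of _ "f - g"]) auto
qed

text \<open>Above \<open>r\<close> every form is a leading part of an element of \<open>J\<close>,
  so the degree can be lowered step by step until it reaches \<open>r\<close>.\<close>

lemma ex_filt_P_top_degree: "\<exists>s\<in>filt_P (int r). f - s \<in> J"
proof -
  have "\<exists>s\<in>filt_P (int r). f - s \<in> J" if "f \<in> filt_P (int n)" for n f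
    using that
  proof (induction n arbitrary: f)
    case 0
    then have "f \<in> filt_P (int r)" using filt_P_mono[of "int 0" "int r"] by auto
    then show ?case using J by (intro bexI[of _ f]) auto
  next
    case (Suc n)
    show ?case
    proof (cases "Suc n \<le> r")
      case True
      then have "f \<in> filt_P (int r)" using filt_P_mono[of "int (Suc n)" "int r"] Suc.prems by auto
      then show ?thesis using J by (intro bexI[of _ f]) auto
    next
      case False
      then have "hom_comp (Suc n) f \<in> lead J (Suc n)" using r by (auto simp: top_degree_def)
      then obtain f' where f': "f' \<in> filt_P (int n)" "f - f' \<in> J"
        using mem_filt_P_plus_ideal_iff[OF Suc.prems] by auto
      obtain s where "s \<in> filt_P (int r)" "f' - s \<in> J" using Suc.IH[OF f'(1)] by blast
      then show ?thesis using ideal_add[OF J f'(2), of "f' - s"] by auto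
    qed
  qed
  then show ?thesis using ex_filt_P[of f] by blast
qed

lemma ex_filt_P_iff: "(\<forall>f. \<exists>s\<in>filt_P j. f - s \<in> J) \<longleftrightarrow> int r \<le> j"
proof
  assume *: "\<forall>f. \<exists>s\<in>filt_P j. f - s \<in> J"
  obtain f where f: "hom_comp r f \<notin> lead J r" using r by (auto simp: top_degree_def)
  show "int r \<le> j"
  proof (rule ccontr)
    assume "\<not> int r \<le> j"
    then have "filt_P j \<subseteq> (filt_P (int r - 1) :: ('x, 'k) mpoly set)" by (intro filt_P_mono) simp
    with * have "\<exists>s\<in>filt_P (int r - 1). hom_comp r f - s \<in> J" by blast
    then show False
      using mem_filt_P_plus_ideal_iff[OF hom_comp_in_filt_P] f by (simp add: hom_comp_hom_comp)
  qed
next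
  assume "int r \<le> j"
  then show "\<forall>f. \<exists>s\<in>filt_P j. f - s \<in> J"
    using ex_filt_P_top_degree filt_P_mono[of "int r" j] by blast
qed

lemma fin_dim_top_degree: "vectorspace.fin_dim coeff_field (quot_space J)"
  unfolding quot_fin_dim_iff[OF J] using ex_filt_P_top_degree by (intro exI[of _ r] allI)

lemma ri_eq: "ri J = int r"
proof -
  have "HFa J j = dim_K J (carrier (mpoly_ring Quot J)) \<longleftrightarrow> int r \<le> j" for j
    unfolding HFa_def filt_R_def
    by (simp add: dim_K_eq_full_iff[OF J fin_dim_top_degree lin_subspace_filt_P] ex_filt_P_iff)
  then show ?thesis unfolding ri_def by (intro Least_equality) auto
qed

text \<open>The right-hand side says that the degree \<open>r\<close> part of the graded ring is a
  line, spanned by the class of \<open>hom_comp r c\<close>. It is the codimension one criterion for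
  the last filtration step, rewritten on leading parts.\<close>

lemma last_difference_eq_1_iff:
  "last_difference J = 1 \<longleftrightarrow>
    (\<exists>c. hom_comp r c \<notin> lead J r \<and>
       (\<forall>f. \<exists>a. hom_comp r f - const_poly a * hom_comp r c \<in> lead J r))"
proof -
  have const: "t - const_poly a * c \<in> filt_P (int r)"
    if "t \<in> filt_P (int r)" "c \<in> filt_P (int r)" for t c :: "('x, 'k) mpoly" and a
    by (rule lin_subspace_diff[OF lin_subspace_filt_P])
      (use that lin_subspace_filt_P[of "int r"] in \<open>auto simp: lin_subspace_def\<close>)
  \<comment> \<open>The lowering criterion applied to \<open>t - const_poly a * c\<close>.\<close>
  have in_lead: "(\<exists>s\<in>filt_P (int r - 1). t - (const_poly a * c + s) \<in> J) \<longleftrightarrow>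
      hom_comp r t - const_poly a * hom_comp r c \<in> lead J r"
    if "t \<in> filt_P (int r)" "c \<in> filt_P (int r)" for t c a
    using mem_filt_P_plus_ideal_iff[OF const[OF that, of a]]
    by (simp add: hom_comp_diff hom_comp_const_mult diff_diff_eq)
  have "last_difference J = 1 \<longleftrightarrow> HFa J (int r) = Suc (HFa J (int r - 1))"
    by (auto simp: last_difference_def ri_eq)
  also have "\<dots> \<longleftrightarrow> (\<exists>c\<in>filt_P (int r). hom_comp r c \<notin> lead J r \<and>
      (\<forall>t\<in>filt_P (int r). \<exists>a. hom_comp r t - const_poly a * hom_comp r c \<in> lead J r))"
    unfolding HFa_def filt_R_def
    by (simp add: dim_K_eq_Suc_iff[OF J fin_dim_top_degree lin_subspace_filt_P lin_subspace_filt_P]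
        filt_P_mono in_lead flip: mem_filt_P_plus_ideal_iff cong: bex_cong)
  also have "\<dots> \<longleftrightarrow> (\<exists>c. hom_comp r c \<notin> lead J r \<and>
       (\<forall>f. \<exists>a. hom_comp r f - const_poly a * hom_comp r c \<in> lead J r))"
    (is "?L \<longleftrightarrow> ?R")
  proof
    assume ?L
    then obtain c where c: "hom_comp r c \<notin> lead J r"
      "\<forall>t\<in>filt_P (int r). \<exists>a. hom_comp r t - const_poly a * hom_comp r c \<in> lead J r" by blast
    have "\<exists>a. hom_comp r f - const_poly a * hom_comp r c \<in> lead J r" for f
      using c(2)[rule_format, OF hom_comp_in_filt_P, of f] by (simp add: hom_comp_hom_comp)
    with c(1) show ?R by blast
  next
    assume ?R
    then obtain c where "hom_comp r c \<notin> lead J r"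
      "\<forall>f. \<exists>a. hom_comp r f - const_poly a * hom_comp r c \<in> lead J r" by blast
    then show ?L
      by (intro bexI[of _ "hom_comp r c"]) (auto simp: hom_comp_hom_comp hom_comp_in_filt_P)
  qed
  finally show ?thesis .
qed

lemma ord_F_eq_ri_iff:
  assumes "f \<notin> J"
  shows "ord_F J (J +>\<^bsub>mpoly_ring\<^esub> f) = int r \<longleftrightarrow> (\<forall>s\<in>filt_P (int r - 1). f - s \<notin> J)"
proof -
  let ?P = "\<lambda>i. \<exists>s\<in>filt_P i. f - s \<in> J"
  have ord: "ord_F J (J +>\<^bsub>mpoly_ring\<^esub> f) = (LEAST i. ?P i)"
    by (simp only: ord_F_def filt_R_def mem_quot_image_iff[OF J])
  have mono: "?P j" if "?P i" "i \<le> j" for i j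
    using that filt_P_mono[of i j] by blast
  \<comment> \<open>Below \<open>0\<close> the filtration is zero and would force \<open>f\<close>
    into \<open>J\<close>. This bound makes the least integer exist.\<close>
  have nonneg: "0 \<le> i" if P: "?P i" for i
  proof (rule ccontr)
    assume "\<not> 0 \<le> i"
    then have "filt_P i = ({0} :: ('x, 'k) mpoly set)" by (auto simp: filt_P_def)
    with P assms show False by auto
  qed
  have top: "?P (int r)" by (rule ex_filt_P_top_degree)
  \<comment> \<open>The integers are not well-ordered, so the minimum is taken over the natural
    numbers first.\<close>
  define n where "n = (LEAST n. ?P (int n))"
  have n: "?P (int n)" unfolding n_def by (rule LeastI[of "\<lambda>n. ?P (int n)", OF top])
  have least: "int n \<le> i" if "?P i" for i
  proof -
    have "?P (int (nat i))" using that nonneg[OF that] by simp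
    then have "n \<le> nat i" unfolding n_def by (rule Least_le)
    then show ?thesis using nonneg[OF that] by simp
  qed
  have eq: "(LEAST i. ?P i) = int n" by (rule Least_equality) (use n least in auto)
  have "int n = int r \<longleftrightarrow> \<not> ?P (int r - 1)"
  proof
    assume "int n = int r"
    then show "\<not> ?P (int r - 1)" using least[of "int r - 1"] by auto
  next
    assume "\<not> ?P (int r - 1)"
    then have "\<not> int n \<le> int r - 1" using mono[OF n] by blast
    then show "int n = int r" using least[OF top] by simp
  qed
  then show ?thesis unfolding ord eq by blast
qed

end


section \<open>The Cayley-Bacharach property of a local ring\<close>

lemma filt_P_const_mult: "f \<in> filt_P i \<Longrightarrow> const_poly a * f \<in> filt_P i"
  using lin_subspace_filt_P unfolding lin_subspace_def by blast

text \<open>The maximal ideal generated by the indeterminates, given by its vanishing constant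
  coefficient so that membership is a computation.\<close>

definition aug_ideal :: "('x::finite, 'k::field) mpoly set" where
  "aug_ideal = {f. Poly_Mapping.lookup f 0 = 0}"

lemma hom_comp_0: "hom_comp 0 f = const_poly (Poly_Mapping.lookup f 0)"
  by (rule poly_mapping_eqI)
    (simp add: lookup_hom_comp const_poly_def lookup_single mon_deg_eq_0_iff when_def)

lemma lookup_const_poly_0 [simp]: "Poly_Mapping.lookup (const_poly c) 0 = c"
  by (simp add: const_poly_def)

lemma lookup_mult_0:
  fixes f g :: "('x::finite, 'k::field) mpoly"
  shows "Poly_Mapping.lookup (f * g) 0 = Poly_Mapping.lookup f 0 * Poly_Mapping.lookup g 0"
proof -
  have "(const_poly (Poly_Mapping.lookup (f * g) 0) :: ('x, 'k) mpoly) =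
      const_poly (Poly_Mapping.lookup f 0 * Poly_Mapping.lookup g 0)"
    using hom_comp_mult[of 0 f g] by (simp add: hom_comp_0 const_poly_simps)
  then show ?thesis by (metis lookup_const_poly_0)
qed

lemma lookup_power_0: "Poly_Mapping.lookup (f ^ n) 0 = Poly_Mapping.lookup f 0 ^ n"
  for f :: "('x::finite, 'k::field) mpoly"
  by (induction n) (simp_all add: lookup_mult_0)

lemma ideal_aug_ideal: "ideal aug_ideal mpoly_ring"
  by (simp add: ideal_ring_of_type_algebra_iff aug_ideal_def lookup_add lookup_mult_0)

lemma diff_const_in_aug_ideal: "f - const_poly (Poly_Mapping.lookup f 0) \<in> aug_ideal"
  by (simp add: aug_ideal_def lookup_minus)

lemma quot_image_UNIV:
  "ideal J mpoly_ring \<Longrightarrow> quot_image J UNIV = carrier (mpoly_ring Quot J)"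
  by (simp add: quot_image_def quot_carrier)

text \<open>Modulo the augmentation ideal every polynomial is congruent to its constant term. This
  dimension is the one prescribed for minimal divisors.\<close>

lemma dim_K_aug_ideal:
  "dim_K (aug_ideal :: ('x::finite, 'k::field) mpoly set) (carrier (mpoly_ring Quot aug_ideal)) = 1"
proof -
  let ?M = "aug_ideal :: ('x, 'k) mpoly set"
  have "\<exists>s\<in>filt_P (int 0). f - s \<in> ?M" for f
    using diff_const_in_aug_ideal[of f] hom_comp_in_filt_P[of 0 f] by (auto simp: hom_comp_0)
  then have "vectorspace.fin_dim coeff_field (quot_space ?M)"
    using quot_fin_dim_iff[OF ideal_aug_ideal] by blast
  moreover have "\<forall>f\<in>UNIV. \<exists>a. f - const_poly a * 1 \<in> ?M"
    using diff_const_in_aug_ideal by auto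
  moreover have "1 \<notin> ?M" by (simp add: aug_ideal_def)
  ultimately show ?thesis
    unfolding quot_image_UNIV[OF ideal_aug_ideal, symmetric]
    using dim_K_eq_1_iff[OF ideal_aug_ideal _ lin_subspace_UNIV] by blast
qed

text \<open>Equivalently, \<open>P/J\<close> is local with nilpotent maximal ideal \<open>aug_ideal/J\<close>.\<close>

definition nil_aug :: "('x::finite, 'k::field) mpoly set \<Rightarrow> bool" where
  "nil_aug J \<longleftrightarrow> ideal J mpoly_ring \<and> 1 \<notin> J \<and> (\<forall>f\<in>aug_ideal. \<exists>n. f ^ n \<in> J)"

text \<open>Invertibility modulo \<open>J\<close> comes from the geometric series of a nilpotent element.\<close>

lemma nil_aug_unit:
  assumes "nil_aug J" "f \<notin> aug_ideal"
  shows "\<exists>g. g * f - 1 \<in> J"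
proof -
  define c where "c = Poly_Mapping.lookup f 0"
  have c: "c \<noteq> 0" using assms(2) by (simp add: c_def aug_ideal_def)
  define u where "u = 1 - const_poly (1 / c) * f"
  have "u \<in> aug_ideal" using c by (simp add: u_def aug_ideal_def lookup_minus lookup_mult_0 c_def)
  then obtain n where n: "u ^ n \<in> J" using assms(1) by (auto simp: nil_aug_def)
  have "(\<Sum>i<n. u ^ i) * const_poly (1 / c) * f - 1 = - (u ^ n)"
    using one_diff_power_eq[of u n] by (simp add: u_def algebra_simps)
  then have "(\<Sum>i<n. u ^ i) * const_poly (1 / c) * f - 1 \<in> J"
    using n assms(1) ideal_uminus by (auto simp: nil_aug_def)
  then show ?thesis by blast
qed

section \<open>Primary decomposition and minimal divisors in the local case\<close>

lemma nil_aug_subset: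
  assumes "nil_aug J"
  shows "J \<subseteq> aug_ideal"
proof
  have J: "ideal J mpoly_ring" using assms by (simp add: nil_aug_def)
  fix f assume f: "f \<in> J"
  show "f \<in> aug_ideal"
  proof (rule ccontr)
    assume "f \<notin> aug_ideal"
    then obtain g where g: "g * f - 1 \<in> J" using nil_aug_unit[OF assms] by blast
    have "g * f - (g * f - 1) \<in> J" by (rule ideal_diff[OF J ideal_mult[OF J f] g])
    then show False using assms by (simp add: nil_aug_def)
  qed
qed

lemma nil_aug_cancel:
  assumes "nil_aug J" "f \<notin> aug_ideal" "f * s \<in> J"
  shows "s \<in> J"
proof -
  have J: "ideal J mpoly_ring" using assms by (simp add: nil_aug_def)
  obtain g where g: "g * f - 1 \<in> J" using nil_aug_unit[OF assms(1,2)] by blast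
  have "g * (f * s) - s * (g * f - 1) \<in> J"
    by (rule ideal_diff[OF J ideal_mult[OF J assms(3)] ideal_mult[OF J g]])
  then show ?thesis by (simp add: algebra_simps)
qed

lemma nil_aug_radical:
  assumes "nil_aug J"
  shows "radical mpoly_ring J = aug_ideal"
proof -
  have "f \<in> aug_ideal" if "f ^ n \<in> J" for f n
    using nil_aug_subset[OF assms] that by (auto simp: aug_ideal_def lookup_power_0)
  then show ?thesis using assms by (auto simp: radical_def nil_aug_def)
qed

text \<open>A factor \<open>b\<close> in the augmentation ideal is nilpotent modulo
  \<open>J\<close>; any other \<open>b\<close> is invertible modulo \<open>J\<close> and can be
  cancelled.\<close>

lemma nil_aug_primary:
  assumes "nil_aug J"
  shows "primary_ideal J mpoly_ring"
proof -
  have "a \<in> J \<or> (\<exists>n. b ^ n \<in> J)" if "a * b \<in> J" for a b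
    using nil_aug_cancel[OF assms, of b a] that assms by (auto simp: nil_aug_def mult.commute)
  then show ?thesis using assms by (auto simp: primary_ideal_def nil_aug_def)
qed

lemma nil_aug_mono:
  assumes "nil_aug J" "J \<subseteq> Q" "ideal Q mpoly_ring" "1 \<notin> Q"
  shows "nil_aug Q"
  using assms unfolding nil_aug_def by blast

text \<open>Every component contains \<open>J\<close>, so its radical is the augmentation ideal.
  Distinct components have distinct radicals, hence there is at most one.\<close>

lemma nil_aug_primary_decomposition:
  fixes J :: "('x::finite, 'k::field) mpoly set"
  assumes nil: "nil_aug J"
  shows "primary_decomposition mpoly_ring QS J \<longleftrightarrow> QS = {J}"
proof
  assume dec: "primary_decomposition mpoly_ring QS J"
  have "radical mpoly_ring Q = aug_ideal" if "Q \<in> QS" for Q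
  proof -
    have Q: "ideal Q mpoly_ring" "Q \<noteq> UNIV" "J \<subseteq> Q"
      using dec that by (auto simp: primary_decomposition_def primary_ideal_def)
    then have "1 \<notin> Q" using ideal.one_imp_carrier[OF Q(1)] by auto
    then show ?thesis using nil_aug_radical nil_aug_mono[OF nil Q(3) Q(1)] by blast
  qed
  moreover have "inj_on (radical mpoly_ring) QS"
    using dec by (simp add: primary_decomposition_def)
  ultimately have eq: "Q = Q'" if "Q \<in> QS" "Q' \<in> QS" for Q Q'
    using that by (simp add: inj_on_def)
  have J: "J = \<Inter>QS" using dec by (simp add: primary_decomposition_def)
  \<comment> \<open>This excludes the empty decomposition, whose intersection is all of
    \<open>P\<close>.\<close>
  have "J \<noteq> UNIV" using nil by (auto simp: nil_aug_def)
  then obtain Q where "Q \<in> QS" using J by fastforce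
  then have "QS = {Q}" using eq by blast
  then show "QS = {J}" using J by simp
next
  assume "QS = {J}"
  moreover have "J \<noteq> UNIV" using nil by (auto simp: nil_aug_def)
  ultimately show "primary_decomposition mpoly_ring QS J"
    using nil_aug_primary[OF nil] by (auto simp: primary_decomposition_def)
qed

text \<open>With \<open>J\<close> as its only component, the divisors are simply the ideals strictly
  above \<open>J\<close>, and minimality means dimension \<open>1\<close> because the residue field
  is \<open>K\<close>.\<close>

lemma nil_aug_CBP_iff:
  assumes nil: "nil_aug J"
  shows "CBP J \<longleftrightarrow> (\<forall>Q. ideal Q mpoly_ring \<and> J \<subset> Q \<and> dim_K J (quot_image J Q) = 1 \<longrightarrow>
    ri_ideal J (quot_image J Q) = ri J)"
proof -
  have "component_divisor {J} J Q \<longleftrightarrow> ideal Q mpoly_ring \<and> J \<subset> Q" for Q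
    by (auto simp: component_divisor_def)
  then show ?thesis
    unfolding CBP_def nil_aug_primary_decomposition[OF nil]
    by (simp add: minimal_divisor_def nil_aug_radical[OF nil] dim_K_aug_ideal conj_assoc)
qed

text \<open>The preimage in \<open>P\<close> of the annihilator of the maximal ideal of
  \<open>P/J\<close>, when \<open>P/J\<close> is local at \<open>aug_ideal\<close>.\<close>

definition socle :: "('x::finite, 'k::field) mpoly set \<Rightarrow> ('x, 'k) mpoly set" where
  "socle J = {s. \<forall>f\<in>aug_ideal. f * s \<in> J}"

lemma ideal_socle: "ideal J mpoly_ring \<Longrightarrow> ideal (socle J) mpoly_ring"
  by (subst ideal_ring_of_type_algebra_iff)
    (auto simp: socle_def distrib_left ideal_add mult.left_commute ideal_mult)

text \<open>On the socle a polynomial acts as its constant term, because the difference lies in the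
  augmentation ideal.\<close>

lemma socle_mult_const:
  assumes "ideal J mpoly_ring" "s \<in> socle J"
  shows "f * s - const_poly (Poly_Mapping.lookup f 0) * s \<in> J"
  using assms(2) diff_const_in_aug_ideal[of f] unfolding socle_def
  by (auto simp flip: left_diff_distrib)

text \<open>Some scalar \<open>a\<close> describes the action of \<open>f\<close> on the line
  \<open>Q/J\<close>. If \<open>a\<close> were non-zero, \<open>f - const_poly a\<close> would be
  invertible modulo \<open>J\<close> and yet kill \<open>c\<close>.\<close>

lemma nil_aug_socle_if_dim_1:
  assumes nil: "nil_aug J" and Q: "ideal Q mpoly_ring" and c: "c \<in> Q" "c \<notin> J"
    and gen: "\<forall>t\<in>Q. \<exists>a. t - const_poly a * c \<in> J"
  shows "c \<in> socle J"
  unfolding socle_def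
proof safe
  fix f :: "('a, 'b) mpoly" assume f: "f \<in> aug_ideal"
  have J: "ideal J mpoly_ring" using nil by (simp add: nil_aug_def)
  obtain a where a: "f * c - const_poly a * c \<in> J"
    using gen ideal_mult[OF Q c(1)] by blast
  show "f * c \<in> J"
  proof (cases "a = 0")
    case False
    then have "f - const_poly a \<notin> aug_ideal"
      using f by (simp add: aug_ideal_def lookup_minus)
    moreover have "(f - const_poly a) * c \<in> J" using a by (simp add: left_diff_distrib)
    ultimately have "c \<in> J" by (rule nil_aug_cancel[OF nil])
    with c show ?thesis by blast
  qed (use a in \<open>simp add: const_poly_simps\<close>)
qed

text \<open>All non-zero elements of a line are non-zero scalar multiples of one another and have
  the same order, so the maximum runs over a single value.\<close>

lemma ri_ideal_dim_1:
  assumes J: "ideal J mpoly_ring" and Q: "c \<in> Q" "c \<notin> J"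
    and gen: "\<forall>t\<in>Q. \<exists>a. t - const_poly a * c \<in> J"
  shows "ri_ideal J (quot_image J Q) = ord_F J (J +>\<^bsub>mpoly_ring\<^esub> c)"
proof -
  let ?c = "(+>\<^bsub>mpoly_ring\<^esub>) J"
  have ord: "ord_F J (?c t) = ord_F J (?c c)" if t: "t \<in> Q" "t \<notin> J" for t
  proof -
    obtain a where a: "t - const_poly a * c \<in> J" using gen t by blast
    then have "a \<noteq> 0" using t(2) by (auto simp: const_poly_simps)
    then have inv: "const_poly (1 / a) * const_poly a = (1 :: ('a, 'b) mpoly)"
      by (simp flip: const_poly_simps)
    have "(\<exists>s\<in>filt_P i. t - s \<in> J) \<longleftrightarrow> (\<exists>s\<in>filt_P i. c - s \<in> J)" for i
    proof
      assume "\<exists>s\<in>filt_P i. t - s \<in> J"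
      then obtain s where s: "s \<in> filt_P i" "t - s \<in> J" by blast
      have "const_poly (1 / a) * ((t - s) - (t - const_poly a * c)) \<in> J"
        by (rule ideal_mult[OF J ideal_diff[OF J s(2) a]])
      also have "const_poly (1 / a) * ((t - s) - (t - const_poly a * c)) =
          const_poly (1 / a) * const_poly a * c - const_poly (1 / a) * s"
        by (simp add: algebra_simps)
      finally have "c - const_poly (1 / a) * s \<in> J" by (simp add: inv)
      moreover have "const_poly (1 / a) * s \<in> filt_P i"
        by (rule filt_P_const_mult[OF s(1)])
      ultimately show "\<exists>s\<in>filt_P i. c - s \<in> J" by blast
    next
      assume "\<exists>s\<in>filt_P i. c - s \<in> J"
      then obtain s where s: "s \<in> filt_P i" "c - s \<in> J" by blast
      have "(t - const_poly a * c) + const_poly a * (c - s) \<in> J"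
        by (rule ideal_add[OF J a ideal_mult[OF J s(2)]])
      then have "t - const_poly a * s \<in> J" by (simp add: algebra_simps)
      moreover have "const_poly a * s \<in> filt_P i"
        by (rule filt_P_const_mult[OF s(1)])
      ultimately show "\<exists>s\<in>filt_P i. t - s \<in> J" by blast
    qed
    then show ?thesis by (simp add: ord_F_def filt_R_def mem_quot_image_iff[OF J])
  qed
  have "?c f = \<zero>\<^bsub>mpoly_ring Quot J\<^esub> \<longleftrightarrow> f \<in> J" for f
    by (simp add: quot_simps[OF J] coset_eq_iff[OF J])
  then have "quot_image J Q - {\<zero>\<^bsub>mpoly_ring Quot J\<^esub>} = ?c ` (Q - J)"
    unfolding quot_image_def by blast
  moreover have "ord_F J ` ?c ` (Q - J) = (\<lambda>_. ord_F J (?c c)) ` (Q - J)"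
    unfolding image_image by (rule image_cong) (auto simp: ord)
  moreover have "\<dots> = {ord_F J (?c c)}"
    using Q by (intro image_constant[of c]) auto
  ultimately show ?thesis by (simp add: ri_ideal_def)
qed

text \<open>Minimal divisors correspond to lines in the socle. Such a line has order
  \<open>r\<close> exactly when its generator is not congruent to an element of
  \<open>filt_P (int r - 1)\<close>.\<close>

lemma nil_aug_CBP_iff_socle:
  assumes nil: "nil_aug J" and r: "top_degree J r"
  shows "CBP J \<longleftrightarrow> (\<forall>s\<in>socle J - J. \<forall>t\<in>filt_P (int r - 1). s - t \<notin> J)"
proof -
  have J: "ideal J mpoly_ring" using nil by (simp add: nil_aug_def)
  note dim1 = dim_K_eq_1_iff[OF J fin_dim_top_degree[OF J r] lin_subspace_ideal]
  show ?thesis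
    unfolding nil_aug_CBP_iff[OF nil] ri_eq[OF J r]
  proof (intro iffI ballI allI impI notI)
    fix s t
    assume cbp: "\<forall>Q. ideal Q mpoly_ring \<and> J \<subset> Q \<and> dim_K J (quot_image J Q) = 1 \<longrightarrow>
        ri_ideal J (quot_image J Q) = int r"
      and "s \<in> socle J - J" and t: "t \<in> filt_P (int r - 1)" "s - t \<in> J"
    then have s: "s \<in> socle J" "s \<notin> J" by auto
    \<comment> \<open>This is \<open>J + K s\<close>. It is an ideal because \<open>P\<close> acts
      on \<open>s\<close> through constant terms modulo \<open>J\<close>, and it is the minimal
      divisor to which the hypothesis is applied.\<close>
    define Q where "Q = {f. \<exists>a. f - const_poly a * s \<in> J}"
    have Q: "ideal Q mpoly_ring"
      unfolding ideal_ring_of_type_algebra_iff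
    proof (intro conjI ballI allI)
      show "0 \<in> Q" using J by (auto simp: Q_def const_poly_simps intro!: exI[of _ 0])
    next
      fix f g assume "f \<in> Q" "g \<in> Q"
      then obtain a b where "f - const_poly a * s \<in> J" "g - const_poly b * s \<in> J"
        by (auto simp: Q_def)
      then have "(f - const_poly a * s) + (g - const_poly b * s) \<in> J" by (rule ideal_add[OF J])
      then have "(f + g) - const_poly (a + b) * s \<in> J"
        by (simp add: algebra_simps const_poly_simps)
      then show "f + g \<in> Q" by (auto simp: Q_def)
    next
      fix f p assume "f \<in> Q"
      then obtain a where a: "f - const_poly a * s \<in> J" by (auto simp: Q_def)
      have "p * (f - const_poly a * s) + const_poly a *
          (p * s - const_poly (Poly_Mapping.lookup p 0) * s) \<in> J"
        by (rule ideal_add[OF J ideal_mult[OF J a] ideal_mult[OF J socle_mult_const[OF J s(1)]]])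
      then have "p * f - const_poly (a * Poly_Mapping.lookup p 0) * s \<in> J"
        by (simp add: algebra_simps const_poly_simps)
      then show "p * f \<in> Q" by (auto simp: Q_def)
    qed
    have "s - const_poly 1 * s \<in> J" using J by (simp add: const_poly_simps)
    then have sQ: "s \<in> Q" unfolding Q_def by blast
    have "f - const_poly 0 * s \<in> J" if "f \<in> J" for f using that by (simp add: const_poly_simps)
    then have "J \<subseteq> Q" unfolding Q_def by blast
    then have JQ: "J \<subset> Q" using sQ s(2) by blast
    have gen: "\<forall>t\<in>Q. \<exists>a. t - const_poly a * s \<in> J" by (simp add: Q_def)
    have "dim_K J (quot_image J Q) = 1"
      using dim1[OF Q] sQ s(2) gen by blast
    then have "ord_F J (J +>\<^bsub>mpoly_ring\<^esub> s) = int r"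
      using cbp Q JQ ri_ideal_dim_1[OF J sQ s(2) gen] by simp
    then show False using ord_F_eq_ri_iff[OF J r s(2)] t by blast
  next
    fix Q
    assume soc: "\<forall>s\<in>socle J - J. \<forall>t\<in>filt_P (int r - 1). s - t \<notin> J"
      and "ideal Q mpoly_ring \<and> J \<subset> Q \<and> dim_K J (quot_image J Q) = 1"
    then have Q: "ideal Q mpoly_ring" "dim_K J (quot_image J Q) = 1" by auto
    then obtain c where c: "c \<in> Q" "c \<notin> J" "\<forall>t\<in>Q. \<exists>a. t - const_poly a * c \<in> J"
      using dim1[OF Q(1)] by blast
    have "c \<in> socle J" by (rule nil_aug_socle_if_dim_1[OF nil Q(1) c])
    then have "ord_F J (J +>\<^bsub>mpoly_ring\<^esub> c) = int r"
      using soc c(2) ord_F_eq_ri_iff[OF J r c(2)] by blast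
    then show "ri_ideal J (quot_image J Q) = int r"
      using ri_ideal_dim_1[OF J c] by simp
  qed
qed


section \<open>Gorenstein rings and the main equivalence\<close>

lemma socle_space_simps:
  "carrier (socle_space A m) = annihilator A m"
  "\<zero>\<^bsub>socle_space A m\<^esub> = \<zero>\<^bsub>A\<^esub>"
  "(\<oplus>\<^bsub>socle_space A m\<^esub>) = (\<oplus>\<^bsub>A\<^esub>)"
  "C \<odot>\<^bsub>socle_space A m\<^esub> v = (THE w. \<exists>a\<in>C. w = a \<otimes>\<^bsub>A\<^esub> v)"
  by (simp_all add: socle_space_def ring.defs module.defs)

context
  fixes J :: "('x::finite, 'k::field) mpoly set"
  assumes nil: "nil_aug J"
begin

private abbreviation A where "A \<equiv> mpoly_ring Quot J"
private abbreviation c where "c f \<equiv> J +>\<^bsub>mpoly_ring\<^esub> f"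
text \<open>This will be the only prime ideal of \<open>A\<close>; \<open>k\<close> is then the
  projection of \<open>P\<close> onto the residue field.\<close>

private definition m where "m = c ` aug_ideal"
private abbreviation k where "k f \<equiv> m +>\<^bsub>A\<^esub> c f"

private lemma J: "ideal J mpoly_ring"
  using nil by (simp add: nil_aug_def)

interpretation A: cring A by (rule quot_cring[OF J])

private lemma c_in_carrier [simp]: "c f \<in> carrier A"
  by (simp add: quot_carrier[OF J])

private lemma carrierE:
  assumes "C \<in> carrier A"
  obtains f where "C = c f"
  using assms by (auto simp: quot_carrier[OF J])

private lemmas c_simps = quot_simps[OF J] coset_eq_iff[OF J]

private lemma c_uminus: "\<ominus>\<^bsub>A\<^esub> c g = c (- g)"
  by (rule A.minus_equality) (simp_all add: quot_simps[OF J] coset_eq_iff[OF J] J)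

private lemma c_minus: "c f \<ominus>\<^bsub>A\<^esub> c g = c (f - g)"
proof -
  have "\<ominus>\<^bsub>A\<^esub> c g = c (- g)" by (rule c_uminus)
  then show ?thesis by (simp add: a_minus_def c_simps)
qed

private lemma c_pow: "c f [^]\<^bsub>A\<^esub> (n :: nat) = c (f ^ n)"
proof (induction n)
  case (Suc n)
  then show ?case by (simp add: c_simps mult.commute)
qed (simp add: c_simps)

private lemma c_mem_m_iff: "c f \<in> m \<longleftrightarrow> f \<in> aug_ideal"
proof
  assume "c f \<in> m"
  then obtain g where g: "g \<in> aug_ideal" "f - g \<in> J" by (auto simp: m_def c_simps)
  then have "f - g \<in> aug_ideal" using nil_aug_subset[OF nil] by blast
  then show "f \<in> aug_ideal" using g(1) by (simp add: aug_ideal_def lookup_minus)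
qed (auto simp: m_def)

text \<open>An element outside \<open>m\<close> is a unit of \<open>A\<close>, and a proper ideal
  contains no unit.\<close>

private lemma proper_ideal_subset_m:
  assumes p: "ideal p A" "p \<noteq> carrier A"
  shows "p \<subseteq> m"
proof
  interpret p: ideal p A by (rule p)
  fix C assume C: "C \<in> p"
  then obtain f where f: "C = c f" using carrierE p.Icarr by blast
  show "C \<in> m"
  proof (rule ccontr)
    assume "C \<notin> m"
    then obtain g where g: "g * f - 1 \<in> J" using nil_aug_unit[OF nil] by (auto simp: f c_mem_m_iff)
    have "c (g * f) = c 1" using g by (simp add: coset_eq_iff[OF J])
    moreover have "c g \<otimes>\<^bsub>A\<^esub> c f \<in> p" using p.I_l_closed[OF C, of "c g"] by (simp add: f)
    ultimately have "\<one>\<^bsub>A\<^esub> \<in> p" by (simp add: quot_simps[OF J])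
    then show False using p(2) p.one_imp_carrier by blast
  qed
qed

private lemma ideal_m: "ideal m A"
proof (rule idealI)
  show "ring A" by (rule A.ring_axioms)
  show "subgroup m (add_monoid A)"
  proof (rule A.add.subgroupI)
    show "m \<subseteq> carrier A" by (auto simp: m_def)
    have "c 0 \<in> m" by (simp add: c_mem_m_iff aug_ideal_def)
    then show "m \<noteq> {}" by blast
    fix C D assume C: "C \<in> m"
    then obtain f where f: "C = c f" "f \<in> aug_ideal" by (auto simp: m_def)
    then show "\<ominus>\<^bsub>A\<^esub> C \<in> m" using f by (simp add: c_uminus c_mem_m_iff ideal_uminus[OF ideal_aug_ideal])
    assume "D \<in> m"
    then obtain g where "D = c g" "g \<in> aug_ideal" by (auto simp: m_def)
    then show "C \<oplus>\<^bsub>A\<^esub> D \<in> m"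
      using f by (simp add: c_simps c_mem_m_iff ideal_add[OF ideal_aug_ideal])
  qed
  fix C D assume "C \<in> m" "D \<in> carrier A"
  then obtain f g where fg: "C = c f" "f \<in> aug_ideal" "D = c g" by (auto simp: m_def elim: carrierE)
  then show "D \<otimes>\<^bsub>A\<^esub> C \<in> m"
    by (simp add: c_simps c_mem_m_iff ideal_mult[OF ideal_aug_ideal])
  then show "C \<otimes>\<^bsub>A\<^esub> D \<in> m"
    using fg A.m_comm[of C D] by simp
qed

private lemma m_neq_carrier: "m \<noteq> carrier A"
proof -
  have "c 1 \<notin> m" by (simp add: c_mem_m_iff aug_ideal_def)
  then show ?thesis using c_in_carrier[of 1] by metis
qed

private lemma maximal_m: "maximalideal m A"
proof (rule maximalidealI[OF ideal_m])
  show "carrier A \<noteq> m" using m_neq_carrier by simp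
  fix p assume "ideal p A" "m \<subseteq> p" "p \<subseteq> carrier A"
  then show "p = m \<or> p = carrier A" using proper_ideal_subset_m[of p] by blast
qed

text \<open>Every element of \<open>m\<close> is nilpotent and hence lies in every prime ideal; the
  other inclusion holds for all proper ideals.\<close>

private lemma prime_eq_m:
  assumes "primeideal p A"
  shows "p = m"
proof
  interpret p: primeideal p A by (rule assms)
  show "p \<subseteq> m" using proper_ideal_subset_m[OF p.is_ideal] p.I_notcarr by simp
  show "m \<subseteq> p"
  proof
    fix C assume "C \<in> m"
    then obtain f where f: "C = c f" "f \<in> aug_ideal" by (auto simp: m_def)
    then obtain n where "f ^ n \<in> J" using nil by (auto simp: nil_aug_def)
    then have "c f [^]\<^bsub>A\<^esub> n = \<zero>\<^bsub>A\<^esub>" by (simp add: c_pow c_simps)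
    then have n: "c f [^]\<^bsub>A\<^esub> n \<in> p" by (simp add: additive_subgroup.zero_closed[OF p.is_additive_subgroup])
    have "c f \<in> p" if "c f [^]\<^bsub>A\<^esub> n \<in> p" for n :: nat
      using that
    proof (induction n)
      case 0
      then show ?case using p.one_imp_carrier p.I_notcarr by simp
    next
      case (Suc n)
      then show ?case using p.I_prime[of "c f [^]\<^bsub>A\<^esub> n" "c f"] by auto
    qed
    then show "C \<in> p" using n f by simp
  qed
qed

private lemma annihilator_m: "annihilator A m = c ` socle J"
proof -
  have "c s \<in> annihilator A m \<longleftrightarrow> s \<in> socle J" for s
    by (auto simp: annihilator_def m_def c_simps socle_def mult.commute)
  then show ?thesis by (auto simp: annihilator_def elim!: carrierE)
qed

private lemma k_simps:
  "k f \<otimes>\<^bsub>A Quot m\<^esub> k g = k (f * g)"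
  "k f \<oplus>\<^bsub>A Quot m\<^esub> k g = k (f + g)"
  "\<one>\<^bsub>A Quot m\<^esub> = k 1"
  using ring_hom_mult[OF ideal.rcos_ring_hom[OF ideal_m], of "c f" "c g"]
    ring_hom_add[OF ideal.rcos_ring_hom[OF ideal_m], of "c f" "c g"]
    ring_hom_one[OF ideal.rcos_ring_hom[OF ideal_m]]
  by (simp_all add: c_simps)

private lemma carrier_Quot_m: "carrier (A Quot m) = range k"
proof -
  have "carrier (A Quot m) = (\<lambda>C. m +>\<^bsub>A\<^esub> C) ` carrier A"
    by (auto simp: FactRing_def A_RCOSETS_def')
  then show ?thesis by (auto simp: quot_carrier[OF J])
qed

text \<open>Two representatives of the scalar differ by an element of \<open>m\<close>, which kills
  \<open>c s\<close>. Hence the definite description in the scalar product has a unique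
  value.\<close>

private lemma socle_smult:
  assumes "s \<in> socle J"
  shows "k f \<odot>\<^bsub>socle_space A m\<^esub> c s = c (f * s)"
proof -
  interpret m: ideal m A by (rule ideal_m)
  have mem: "c f \<in> k f" by (rule m.a_rcos_self) simp
  have uniq: "a \<otimes>\<^bsub>A\<^esub> c s = c (f * s)" if a: "a \<in> k f" for a
  proof -
    obtain b where b: "b \<in> m" "a = b \<oplus>\<^bsub>A\<^esub> c f" using a by (auto simp: a_r_coset_def')
    then obtain g where g: "g \<in> aug_ideal" "b = c g" by (auto simp: m_def)
    then show ?thesis using assms by (simp add: b c_simps socle_def distrib_right)
  qed
  show ?thesis unfolding socle_space_simps
  proof (rule the_equality)
    show "\<exists>a\<in>k f. c (f * s) = a \<otimes>\<^bsub>A\<^esub> c s" using mem uniq by metis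
  qed (use uniq in auto)
qed

private lemma socle_space_vectorspace: "vectorspace (A Quot m) (socle_space A m)"
proof -
  have K: "field (A Quot m)"
    by (rule maximalideal.quotient_is_field[OF maximal_m A.cring_axioms])
  have S: "ideal (socle J) mpoly_ring" by (rule ideal_socle[OF J])
  note simps = socle_space_simps(1-3) annihilator_m carrier_Quot_m socle_smult k_simps c_simps
    ideal_add[OF S] ideal_mult[OF S]
  have "module (A Quot m) (socle_space A m)"
  proof (rule moduleI)
    show "cring (A Quot m)" using K by (simp add: field_def domain_def)
    show "abelian_group (socle_space A m)"
    proof (rule abelian_groupI)
      show "\<zero>\<^bsub>socle_space A m\<^esub> \<in> carrier (socle_space A m)"
        using ideal_zero[OF S] by (simp add: simps(1-4) quot_simps[OF J])
      fix v assume "v \<in> carrier (socle_space A m)"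
      then obtain s where s: "v = c s" "s \<in> socle J" by (auto simp: simps)
      then show "\<exists>w\<in>carrier (socle_space A m). w \<oplus>\<^bsub>socle_space A m\<^esub> v = \<zero>\<^bsub>socle_space A m\<^esub>"
        using ideal_uminus[OF S] J by (intro bexI[of _ "c (- s)"]) (auto simp: simps)
    qed (use J in \<open>auto simp: simps add_ac\<close>)
  qed (use J in \<open>auto simp: simps algebra_simps\<close>)
  with K show ?thesis by (simp add: vectorspace_def)
qed

private lemma socle_space_dim_1_iff:
  "vectorspace.fin_dim (A Quot m) (socle_space A m) \<and>
   vectorspace.dim (A Quot m) (socle_space A m) = 1 \<longleftrightarrow>
   (\<exists>d\<in>socle J - J. \<forall>s\<in>socle J. \<exists>a. s - const_poly a * d \<in> J)"
proof -
  interpret V: vectorspace "A Quot m" "socle_space A m" by (rule socle_space_vectorspace)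
  have iff: "(\<exists>d\<in>carrier (socle_space A m) - {\<zero>\<^bsub>socle_space A m\<^esub>}. \<forall>v\<in>carrier (socle_space A m).
      \<exists>a\<in>carrier (A Quot m). v = a \<odot>\<^bsub>socle_space A m\<^esub> d) \<longleftrightarrow>
    (\<exists>d\<in>socle J - J. \<forall>s\<in>socle J. \<exists>a. s - const_poly a * d \<in> J)"
  proof -
    \<comment> \<open>Scalars from the residue field are classes of polynomials; on a socle element
      they may be replaced by their constant terms.\<close>
    have eq: "(\<exists>f. s - f * d \<in> J) \<longleftrightarrow> (\<exists>a. s - const_poly a * d \<in> J)" if d: "d \<in> socle J" for s d
    proof
      assume "\<exists>f. s - f * d \<in> J"
      then obtain f where f: "s - f * d \<in> J" ..
      have "(s - f * d) + (f * d - const_poly (Poly_Mapping.lookup f 0) * d) \<in> J"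
        by (rule ideal_add[OF J f socle_mult_const[OF J d]])
      then show "\<exists>a. s - const_poly a * d \<in> J" by auto
    qed auto
    have ex: "(\<exists>d\<in>c ` socle J - {\<zero>\<^bsub>A\<^esub>}. P d) \<longleftrightarrow> (\<exists>d\<in>socle J - J. P (c d))" for P
    proof -
      have "c d = \<zero>\<^bsub>A\<^esub> \<longleftrightarrow> d \<in> J" for d by (simp add: c_simps)
      then show ?thesis by blast
    qed
    have all: "(\<forall>v\<in>c ` socle J. \<exists>a\<in>range k. v = a \<odot>\<^bsub>socle_space A m\<^esub> c d) \<longleftrightarrow>
        (\<forall>s\<in>socle J. \<exists>a. s - const_poly a * d \<in> J)" if "d \<in> socle J" for d
      using that by (simp add: socle_smult c_simps eq)
    show ?thesis
      unfolding socle_space_simps(1,2) annihilator_m carrier_Quot_m ex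
      by (rule bex_cong[OF refl], rule all, erule DiffD1)
  qed
  show ?thesis
  proof
    assume *: "V.fin_dim \<and> V.dim = 1"
    show "\<exists>d\<in>socle J - J. \<forall>s\<in>socle J. \<exists>a. s - const_poly a * d \<in> J"
      using V.dim_eq_1_iff[OF conjunct1[OF *]] conjunct2[OF *] unfolding iff by (rule iffD1)
  next
    assume "\<exists>d\<in>socle J - J. \<forall>s\<in>socle J. \<exists>a. s - const_poly a * d \<in> J"
    then have ex: "\<exists>d\<in>carrier (socle_space A m) - {\<zero>\<^bsub>socle_space A m\<^esub>}.
        \<forall>v\<in>carrier (socle_space A m). \<exists>a\<in>carrier (A Quot m). v = a \<odot>\<^bsub>socle_space A m\<^esub> d"
      by (simp only: iff)
    then obtain d where d: "d \<in> carrier (socle_space A m)"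
      "\<forall>v\<in>carrier (socle_space A m). \<exists>a\<in>carrier (A Quot m). v = a \<odot>\<^bsub>socle_space A m\<^esub> d"
      by blast
    \<comment> \<open>Finite dimension must be established before the dimension criterion applies;
      the single generator \<open>d\<close> provides it.\<close>
    have sub: "{d} \<subseteq> carrier (socle_space A m)" using d by simp
    have W: "submodule (A Quot m) (V.span {d}) (socle_space A m)" by (rule V.span_is_submodule[OF sub])
    have "a \<odot>\<^bsub>socle_space A m\<^esub> d \<in> V.span {d}" if "a \<in> carrier (A Quot m)" for a
      using submodule.smult_closed[OF W that] V.in_own_span[OF sub] by simp
    then have "carrier (socle_space A m) \<subseteq> V.span {d}" using d(2) by fast
    then have "V.span {d} = carrier (socle_space A m)" using V.span_is_subset2[OF sub] by simp
    then have fin: "V.fin_dim"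
      unfolding V.fin_dim_def using sub by (intro exI[of _ "{d}"] conjI) auto
    show "V.fin_dim \<and> V.dim = 1"
      by (rule conjI[OF fin V.dim_eq_1_iff[OF fin, THEN iffD2, OF ex]])
  qed
qed

lemma nil_aug_Gorenstein_iff:
  "zero_dim_local_Gorenstein (mpoly_ring Quot J) \<longleftrightarrow>
   (\<exists>d\<in>socle J - J. \<forall>s\<in>socle J. \<exists>a. s - const_poly a * d \<in> J)"
proof -
  have "maximalideal p A \<longleftrightarrow> p = m" for p
    using maximal_m prime_eq_m A.maximalideal_prime by blast
  then have "(\<forall>p'. maximalideal p' A \<longleftrightarrow> p' = p) \<longleftrightarrow> p = m" for p by auto
  moreover have "\<forall>p. primeideal p A \<longrightarrow> maximalideal p A"
    using prime_eq_m maximal_m by blast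
  ultimately show ?thesis
    unfolding zero_dim_local_Gorenstein_def socle_space_dim_1_iff[symmetric]
    using A.cring_axioms by simp
qed

end

section \<open>The graded ring is local, and its top degree part lies in the socle\<close>

lemma nil_aug_DF:
  assumes J: "ideal J mpoly_ring" and r: "top_degree J r"
  shows "nil_aug (DF J)"
  unfolding nil_aug_def
proof (intro conjI ballI)
  show D: "ideal (DF J) mpoly_ring" by (rule ideal_DF[OF J])
  show "1 \<notin> DF J"
  proof
    assume "1 \<in> DF J"
    then have "f \<in> DF J" for f using ideal_mult[OF D, of 1 f] by simp
    then show False using r by (auto simp: top_degree_def mem_DF_iff[OF J])
  qed
  fix f :: "('a, 'b) mpoly" assume f: "f \<in> aug_ideal"
  \<comment> \<open>Without a constant term, each factor raises the lowest possible degree by at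
    least one.\<close>
  have "hom_comp i (f ^ n) = 0" if "i < n" for i n
    using that
  proof (induction n arbitrary: i)
    case (Suc n)
    have "hom_comp j f * hom_comp (i - j) (f ^ n) = 0" if "j \<le> i" for j
    proof (cases "j = 0")
      case True
      then show ?thesis using f by (simp add: hom_comp_0 aug_ideal_def const_poly_simps)
    next
      case False
      then show ?thesis using Suc.IH[of "i - j"] Suc.prems that by simp
    qed
    then show ?case by (simp add: hom_comp_mult)
  qed simp
  \<comment> \<open>The exponent \<open>Suc r\<close> makes all components up to degree
    \<open>r\<close> vanish; above \<open>r\<close> every form is in \<open>lead J\<close>.\<close>
  then have "hom_comp i (f ^ Suc r) \<in> lead J i" for i
    using r lin_subspace_lead[OF J, of i]
    by (cases "i \<le> r") (simp_all add: top_degree_def lin_subspace_def del: power_Suc)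
  then show "\<exists>n. f ^ n \<in> DF J" unfolding mem_DF_iff[OF J] by blast
qed

text \<open>Multiplication by an element of the augmentation ideal moves a form of degree
  \<open>r\<close> into higher degrees, where \<open>DF J\<close> contains everything.\<close>

lemma hom_comp_in_socle_DF:
  assumes J: "ideal J mpoly_ring" and r: "top_degree J r"
  shows "hom_comp r f \<in> socle (DF J)"
proof -
  have "hom_comp i (g * hom_comp r f) \<in> lead J i" if g: "g \<in> aug_ideal" for g i
  proof (cases "i \<le> r")
    case True
    have "hom_comp j g * hom_comp (i - j) (hom_comp r f) = 0" if "j \<le> i" for j
      using g that True
      by (cases "j = 0") (auto simp: hom_comp_0 aug_ideal_def const_poly_simps hom_comp_hom_comp)
    then show ?thesis
      using lin_subspace_lead[OF J, of i] by (simp add: hom_comp_mult lin_subspace_def)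
  qed (use r in \<open>simp add: top_degree_def\<close>)
  then show ?thesis by (simp add: socle_def mem_DF_iff[OF J])
qed

theorem theorem6p12:
  fixes I :: "('x::finite, 'k::field) mpoly set"
  assumes "zero_dim_ideal I"
  shows "strict_Gorenstein I \<longleftrightarrow> strict_CBP I \<and> last_difference I = 1"
proof -
  have I: "ideal I mpoly_ring" using assms by (simp add: zero_dim_ideal_def)
  obtain r where r: "top_degree I r" using ex_top_degree[OF assms] ..
  define D where "D = DF I"
  have D: "ideal D mpoly_ring" unfolding D_def by (rule ideal_DF[OF I])
  have rD: "top_degree D r" unfolding D_def using r top_degree_DF[OF I] by simp
  have nil: "nil_aug D" unfolding D_def by (rule nil_aug_DF[OF I r])
  have leadD: "lead D i = lead I i" for i unfolding D_def by (rule lead_DF[OF I])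
  have top: "hom_comp r f \<in> socle D" for f
    unfolding D_def by (rule hom_comp_in_socle_DF[OF I r])
  \<comment> \<open>A degree \<open>r\<close> form that is non-zero in the graded ring has order
    exactly \<open>r\<close> there. With \<open>s = 0\<close> this also shows that it is not in
    \<open>D\<close>.\<close>
  have notin: "hom_comp r f - s \<notin> D"
    if "hom_comp r f \<notin> lead I r" "s \<in> filt_P (int r - 1)" for f s
    using mem_filt_P_plus_ideal_iff[OF D rD hom_comp_in_filt_P[of r f]] that
    by (auto simp: hom_comp_hom_comp leadD)
  have Gor: "strict_Gorenstein I \<longleftrightarrow>
      (\<exists>d\<in>socle D - D. \<forall>s\<in>socle D. \<exists>a. s - const_poly a * d \<in> D)"
    unfolding strict_Gorenstein_def D_def[symmetric] by (rule nil_aug_Gorenstein_iff[OF nil])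
  have CBP: "strict_CBP I \<longleftrightarrow> (\<forall>s\<in>socle D - D. \<forall>t\<in>filt_P (int r - 1). s - t \<notin> D)"
    unfolding strict_CBP_def D_def[symmetric] by (rule nil_aug_CBP_iff_socle[OF nil rD])
  have zero: "0 \<in> filt_P (int r - 1)" by (simp add: filt_P_def)
  have const: "const_poly (a / b) * (const_poly b * p) = const_poly a * p" if "b \<noteq> 0"
    for a b :: 'k and p :: "('x, 'k) mpoly"
    using that by (simp flip: mult.assoc const_poly_simps(2))
  show ?thesis
  proof
    assume "strict_Gorenstein I"
    then obtain d where d: "d \<in> socle D" "d \<notin> D"
      and gen: "\<And>s. s \<in> socle D \<Longrightarrow> \<exists>a. s - const_poly a * d \<in> D"
      unfolding Gor by blast
    obtain f where f: "hom_comp r f \<notin> lead I r" using r by (auto simp: top_degree_def)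
    define h where "h = hom_comp r f"
    \<comment> \<open>The form \<open>h\<close> lies in the socle line and is non-zero, so it
      generates that line as well as \<open>d\<close> does.\<close>
    obtain a where a: "h - const_poly a * d \<in> D" using gen top unfolding h_def by blast
    have "h \<notin> D" using notin[OF f zero] by (simp add: h_def)
    then have "a \<noteq> 0" using a by (auto simp: const_poly_simps)
    have "s - t \<notin> D" if s: "s \<in> socle D - D" and t: "t \<in> filt_P (int r - 1)" for s t
    proof
      assume st: "s - t \<in> D"
      obtain b where b: "s - const_poly b * d \<in> D" using gen s by blast
      then have "b \<noteq> 0" using s by (auto simp: const_poly_simps)
      \<comment> \<open>Modulo \<open>D\<close> both \<open>s\<close> and \<open>t\<close> equal
        \<open>b d\<close>, while \<open>h\<close> equals \<open>a d\<close>; so \<open>h\<close>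
        would be congruent to \<open>(a / b) t\<close>, which has degree below
        \<open>r\<close>.\<close>
      have "(h - const_poly a * d) + const_poly (a / b) * ((s - t) - (s - const_poly b * d)) \<in> D"
        by (rule ideal_add[OF D a ideal_mult[OF D ideal_diff[OF D st b]]])
      then have "h - const_poly (a / b) * t \<in> D"
        by (simp add: right_diff_distrib const[OF \<open>b \<noteq> 0\<close>])
      moreover have "const_poly (a / b) * t \<in> filt_P (int r - 1)"
        by (rule filt_P_const_mult[OF t])
      ultimately show False using notin[OF f] by (simp add: h_def)
    qed
    then have "strict_CBP I" unfolding CBP by blast
    moreover have "\<exists>b. hom_comp r g - const_poly b * hom_comp r f \<in> lead I r" for g
    proof -
      obtain b where b: "hom_comp r g - const_poly b * d \<in> D" using gen top by blast
      have "(hom_comp r g - const_poly b * d) - const_poly (b / a) * (h - const_poly a * d) \<in> D"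
        by (rule ideal_diff[OF D b ideal_mult[OF D a]])
      then have "hom_comp r g - const_poly (b / a) * h \<in> D"
        by (simp add: right_diff_distrib const[OF \<open>a \<noteq> 0\<close>])
      \<comment> \<open>Taking degree \<open>r\<close> parts turns membership in \<open>D\<close>
        into membership in \<open>lead I r\<close>.\<close>
      then have "hom_comp r (hom_comp r g - const_poly (b / a) * h) \<in> lead I r"
        unfolding D_def mem_DF_iff[OF I] by blast
      then show ?thesis
        by (auto simp: hom_comp_diff hom_comp_const_mult hom_comp_hom_comp h_def)
    qed
    then have "last_difference I = 1" using last_difference_eq_1_iff[OF I r] f by blast
    ultimately show "strict_CBP I \<and> last_difference I = 1" ..
  next
    assume *: "strict_CBP I \<and> last_difference I = 1"
    then obtain f where f: "hom_comp r f \<notin> lead I r"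
      and gen: "\<And>g. \<exists>a. hom_comp r g - const_poly a * hom_comp r f \<in> lead I r"
      using last_difference_eq_1_iff[OF I r] by blast
    define h where "h = hom_comp r f"
    have h: "h \<in> socle D" "h \<notin> D" "h \<in> filt_P (int r)"
      using top notin[OF f zero] hom_comp_in_filt_P by (simp_all add: h_def)
    have "\<exists>a. s - const_poly a * h \<in> D" if s: "s \<in> socle D" for s
    proof -
      \<comment> \<open>A suitable multiple of \<open>h\<close> removes the degree \<open>r\<close>
        part of \<open>t\<close>. What remains of \<open>s\<close> is a socle element congruent to
        one of degree below \<open>r\<close>, and the Cayley-Bacharach property forces it into
        \<open>D\<close>.\<close>
      obtain t where t: "t \<in> filt_P (int r)" "s - t \<in> D"
        using ex_filt_P_top_degree[OF D rD] by blast
      obtain a where "hom_comp r t - const_poly a * h \<in> lead I r"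
        using gen unfolding h_def by blast
      then have "hom_comp r (t - const_poly a * h) \<in> lead D r"
        by (simp add: leadD hom_comp_diff hom_comp_const_mult hom_comp_hom_comp h_def)
      moreover have "t - const_poly a * h \<in> filt_P (int r)"
        by (rule lin_subspace_diff[OF lin_subspace_filt_P t(1) filt_P_const_mult[OF h(3)]])
      ultimately obtain u where u: "u \<in> filt_P (int r - 1)" "t - const_poly a * h - u \<in> D"
        using mem_filt_P_plus_ideal_iff[OF D rD] by blast
      have "(s - t) + (t - const_poly a * h - u) \<in> D" by (rule ideal_add[OF D t(2) u(2)])
      then have "(s - const_poly a * h) - u \<in> D" by (simp add: algebra_simps)
      moreover have "s - const_poly a * h \<in> socle D"
        using ideal_diff[OF ideal_socle[OF D] s ideal_mult[OF ideal_socle[OF D] h(1)]] .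
      ultimately show ?thesis using * u(1) unfolding CBP by blast
    qed
    then show "strict_Gorenstein I" unfolding Gor using h by blast
  qed
qed

end
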